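(* Let $\mathcal{M}=(\mathbb{R}^+\times\mathbb{R},\nabla)$, where $\nabla$ is a non-flat torsion-free connection with Christoffel symbols $\Gamma_{ij}{}^k=(x^1)^{-1}C_{ij}{}^k$, $C_{ij}{}^k=C_{ji}{}^k$ constant. The space $\mathfrak{A}(\mathcal{M})$ is non-empty if and only if at least one of the following possibilities holds up to linear equivalence: \begin{enumerate} \item $\mathcal{M}$ is also of Type $\mathcal{A}$, i.e. $C_{12}{}^1=0$, $C_{22}{}^1=0$, and $C_{22}{}^2=0$. \item $\mathcal{M}$ is isomorphic to $\mathcal{P}_{a,c}^\pm$ for some $(a,c)\ne(0,0)$ or to $\mathcal{Q}_c$ for some (arbitrary) $c$. \end{enumerate}
   Context: $\nabla_{\partial_i}\partial_j=\Gamma_{ij}{}^k\partial_k$. $R(\xi_1,\xi_2)=\nabla_{\xi_1}\nabla_{\xi_2}-\nabla_{\xi_2}\nabla_{\xi_1}-\nabla_{[\xi_1,\xi_2]}$, $\rho(\xi_1,\xi_2)=\operatorname{Tr}\{\xi_3\mapsto R(\xi_3,\xi_1)\xi_2\}$, and $\rho^s$ is the symmetrization of $\rho$. $H_f^\nabla=\nabla(df)$ is the Hessian. $\mathfrak{A}(\mathcal{M})$ is the set of $f\in C^\infty(M)$ with $H_f^\nabla+\rho^s=0$ (affine gradient Ricci solitons). Type $\mathcal{A}$ means locally homogeneous, non-flat, and admitting near each point local coordinates with constant Christoffel symbols. Two structures $C,\tilde C$ on $\mathbb{R}^+\times\mathbb{R}$ are linearly equivalent if $\tilde C=T^*C$ for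 some $T:(x^1,x^2)\mapsto(x^1,bx^1+cx^2)$, $c\ne0$. For $(a,c)\ne(0,0)$, $c\ge0$, the surfaces $\mathcal{P}_{a,c}^\pm$ are given by $\Gamma=(x^1)^{-1}C$ with $C_{11}{}^1=\frac12(a^2+4a\mp2c^2+2)$, $C_{11}{}^2=c$, $C_{12}{}^1=0$, $C_{12}{}^2=\frac12(a^2+2a\mp2c^2)$, $C_{22}{}^1=\pm1$, $C_{22}{}^2=\pm2c$. For $c\in\mathbb{R}$, $\mathcal{Q}_c$ is given by $C_{11}{}^1=0$, $C_{11}{}^2=c$, $C_{12}{}^1=1$, $C_{12}{}^2=0$, $C_{22}{}^1=0$, $C_{22}{}^2=1$. *)

theory Defs
  imports "HOL-Analysis.Analysis"
begin

type_synonym point = "real^2"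
type_synonym vfield = "point \<Rightarrow> real^2"

text \<open>\<open>C i j k\<close> stands for $C_{ij}{}^k$, and \<open>\<Gamma> p i j k\<close> for $\Gamma_{ij}{}^k(p)$.\<close>

type_synonym coeffs = "2 \<Rightarrow> 2 \<Rightarrow> 2 \<Rightarrow> real"
type_synonym connection = "point \<Rightarrow> coeffs"

text \<open>Smoothness on an open set, through iterated partial derivatives.\<close>

primrec Ck_on :: "nat \<Rightarrow> point set \<Rightarrow> (point \<Rightarrow> 'a::real_normed_vector) \<Rightarrow> bool" where
  "Ck_on 0 S f \<longleftrightarrow> continuous_on S f"
| "Ck_on (Suc n) S f \<longleftrightarrow> f differentiable_on S \<and>
     (\<forall>i. Ck_on n S (\<lambda>p. frechet_derivative f (at p) (axis i 1)))"

definition smooth_on :: "point set \<Rightarrow> (point \<Rightarrow> 'a::real_normed_vector) \<Rightarrow> bool" where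
  "smooth_on S f \<longleftrightarrow> (\<forall>n. Ck_on n S f)"

definition coord_field :: "2 \<Rightarrow> vfield" where
  "coord_field i = (\<lambda>p. axis i 1)"

definition cov :: "connection \<Rightarrow> vfield \<Rightarrow> vfield \<Rightarrow> vfield" where
  "cov \<Gamma> X Y = (\<lambda>p. frechet_derivative Y (at p) (X p)
      + (\<chi> k. \<Sum>i\<in>UNIV. \<Sum>j\<in>UNIV. X p $ i * Y p $ j * \<Gamma> p i j k))"

definition bracket :: "vfield \<Rightarrow> vfield \<Rightarrow> vfield" where
  "bracket X Y = (\<lambda>p. frechet_derivative Y (at p) (X p) - frechet_derivative X (at p) (Y p))"

definition curvature :: "connection \<Rightarrow> vfield \<Rightarrow> vfield \<Rightarrow> vfield \<Rightarrow> vfield" where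
  "curvature \<Gamma> X Y Z =
     (\<lambda>p. cov \<Gamma> X (cov \<Gamma> Y Z) p - cov \<Gamma> Y (cov \<Gamma> X Z) p - cov \<Gamma> (bracket X Y) Z p)"

definition flat_on :: "point set \<Rightarrow> connection \<Rightarrow> bool" where
  "flat_on M \<Gamma> \<longleftrightarrow>
     (\<forall>p\<in>M. \<forall>i j k. curvature \<Gamma> (coord_field i) (coord_field j) (coord_field k) p = 0)"

text \<open>The trace of $\xi_3 \mapsto R(\xi_3,X)Y$, taken in the coordinate frame.\<close>

definition ricci :: "connection \<Rightarrow> vfield \<Rightarrow> vfield \<Rightarrow> point \<Rightarrow> real" where
  "ricci \<Gamma> X Y = (\<lambda>p. \<Sum>i\<in>UNIV. curvature \<Gamma> (coord_field i) X Y p $ i)"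

definition ricci_sym :: "connection \<Rightarrow> vfield \<Rightarrow> vfield \<Rightarrow> point \<Rightarrow> real" where
  "ricci_sym \<Gamma> X Y = (\<lambda>p. (ricci \<Gamma> X Y p + ricci \<Gamma> Y X p) / 2)"

text \<open>$(\nabla df)(X,Y) = X(df(Y)) - df(\nabla_X Y)$.\<close>

definition hessian :: "connection \<Rightarrow> (point \<Rightarrow> real) \<Rightarrow> vfield \<Rightarrow> vfield \<Rightarrow> point \<Rightarrow> real" where
  "hessian \<Gamma> f X Y = (\<lambda>p.
     frechet_derivative (\<lambda>q. frechet_derivative f (at q) (Y q)) (at p) (X p)
     - frechet_derivative f (at p) (cov \<Gamma> X Y p))"

text \<open>The set $\mathfrak{A}$; values of a function outside \<open>M\<close> are irrelevant.\<close>

definition solitons :: "point set \<Rightarrow> connection \<Rightarrow> (point \<Rightarrow> real) set" where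
  "solitons M \<Gamma> = {f. smooth_on M f \<and>
     (\<forall>p\<in>M. \<forall>i j. hessian \<Gamma> f (coord_field i) (coord_field j) p
        + ricci_sym \<Gamma> (coord_field i) (coord_field j) p = 0)}"

text \<open>A diffeomorphism \<open>\<phi>\<close> of the open set \<open>U\<close> onto the open set \<open>\<phi> ` U\<close>, with inverse \<open>\<psi>\<close>;
  \<open>chart_frame \<phi> \<psi> i\<close> is the coordinate vector field $\partial/\partial y^i$ on \<open>U\<close>
  of the coordinates $y = \phi$.\<close>

definition chart :: "point set \<Rightarrow> (point \<Rightarrow> point) \<Rightarrow> (point \<Rightarrow> point) \<Rightarrow> bool" where
  "chart U \<phi> \<psi> \<longleftrightarrow> open U \<and> open (\<phi> ` U) \<and> (\<forall>p\<in>U. \<psi> (\<phi> p) = p)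
     \<and> smooth_on U \<phi> \<and> smooth_on (\<phi> ` U) \<psi>"

definition chart_frame :: "(point \<Rightarrow> point) \<Rightarrow> (point \<Rightarrow> point) \<Rightarrow> 2 \<Rightarrow> vfield" where
  "chart_frame \<phi> \<psi> i = (\<lambda>p. frechet_derivative \<psi> (at (\<phi> p)) (axis i 1))"

text \<open>The Christoffel symbols of \<open>\<Gamma>\<close> in the coordinates \<open>\<phi>\<close> are \<open>\<Gamma>'\<close>. Equivalently, \<open>\<phi>\<close> is an
  affine diffeomorphism of \<open>(U, \<Gamma>)\<close> onto \<open>(\<phi> ` U, \<Gamma>')\<close>.\<close>

definition christoffel_in_chart ::
  "connection \<Rightarrow> point set \<Rightarrow> (point \<Rightarrow> point) \<Rightarrow> (point \<Rightarrow> point) \<Rightarrow> connection \<Rightarrow> bool" where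
  "christoffel_in_chart \<Gamma> U \<phi> \<psi> \<Gamma>' \<longleftrightarrow> (\<forall>p\<in>U. \<forall>i j.
     cov \<Gamma> (chart_frame \<phi> \<psi> i) (chart_frame \<phi> \<psi> j) p
       = (\<Sum>k\<in>UNIV. \<Gamma>' (\<phi> p) i j k *\<^sub>R chart_frame \<phi> \<psi> k p))"

definition locally_homogeneous :: "point set \<Rightarrow> connection \<Rightarrow> bool" where
  "locally_homogeneous M \<Gamma> \<longleftrightarrow> (\<forall>p\<in>M. \<forall>q\<in>M. \<exists>U \<phi> \<psi>.
     chart U \<phi> \<psi> \<and> p \<in> U \<and> U \<subseteq> M \<and> \<phi> ` U \<subseteq> M \<and> \<phi> p = q
     \<and> christoffel_in_chart \<Gamma> U \<phi> \<psi> \<Gamma>)"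

definition type_A :: "point set \<Rightarrow> connection \<Rightarrow> bool" where
  "type_A M \<Gamma> \<longleftrightarrow> locally_homogeneous M \<Gamma> \<and> \<not> flat_on M \<Gamma> \<and>
     (\<forall>p\<in>M. \<exists>U \<phi> \<psi> A. chart U \<phi> \<psi> \<and> p \<in> U \<and> U \<subseteq> M
        \<and> christoffel_in_chart \<Gamma> U \<phi> \<psi> (\<lambda>_. A))"

definition half_plane :: "point set" where
  "half_plane = {p. p $ 1 > 0}"

definition type_B_connection :: "coeffs \<Rightarrow> connection" where
  "type_B_connection C = (\<lambda>p i j k. C i j k / p $ 1)"

text \<open>The matrix of $T : (x^1,x^2) \mapsto (x^1, b x^1 + c x^2)$, and the pullback $T^*C$.
  As $T$ preserves $x^1$, the factor $(x^1)^{-1}$ is unaffected by the pullback, so that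
  $C$ transforms as a tensor.\<close>

definition shear :: "real \<Rightarrow> real \<Rightarrow> real^2^2" where
  "shear b c = vector [vector [1, 0], vector [b, c]]"

definition linear_pullback :: "real^2^2 \<Rightarrow> coeffs \<Rightarrow> coeffs" where
  "linear_pullback T C = (\<lambda>i j k. \<Sum>l\<in>UNIV. \<Sum>m\<in>UNIV. \<Sum>n\<in>UNIV.
     T $ l $ i * T $ m $ j * C l m n * matrix_inv T $ k $ n)"

definition linearly_equivalent :: "coeffs \<Rightarrow> coeffs \<Rightarrow> bool" where
  "linearly_equivalent C C' \<longleftrightarrow> (\<exists>b c. c \<noteq> 0 \<and> C' = linear_pullback (shear b c) C)"

text \<open>Arguments in the order
  $C_{11}{}^1$, $C_{11}{}^2$, $C_{12}{}^1$, $C_{12}{}^2$, $C_{22}{}^1$, $C_{22}{}^2$.\<close>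

definition sym_coeffs :: "real \<Rightarrow> real \<Rightarrow> real \<Rightarrow> real \<Rightarrow> real \<Rightarrow> real \<Rightarrow> coeffs" where
  "sym_coeffs c111 c112 c121 c122 c221 c222 = (\<lambda>i j k.
     if i = 1 \<and> j = 1 then (if k = 1 then c111 else c112)
     else if i = 2 \<and> j = 2 then (if k = 1 then c221 else c222)
     else (if k = 1 then c121 else c122))"

text \<open>$\mathcal{P}_{a,c}^+$ is \<open>P_coeffs 1 a c\<close> and $\mathcal{P}_{a,c}^-$ is \<open>P_coeffs (- 1) a c\<close>.\<close>

definition P_coeffs :: "real \<Rightarrow> real \<Rightarrow> real \<Rightarrow> coeffs" where
  "P_coeffs \<epsilon> a c = sym_coeffs
     ((a^2 + 4 * a - \<epsilon> * (2 * c^2) + 2) / 2) c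
     0 ((a^2 + 2 * a - \<epsilon> * (2 * c^2)) / 2)
     \<epsilon> (\<epsilon> * (2 * c))"

definition Q_coeffs :: "real \<Rightarrow> coeffs" where
  "Q_coeffs c = sym_coeffs 0 c 1 0 0 1"

end

theory Submission
  imports Defs
begin

text \<open>
  Put \<open>g\<^sub>j = x\<^sup>1 \<partial>\<^sub>j f\<close>. The soliton equation says that each \<open>x\<^sup>1 \<partial>\<^sub>i g\<^sub>j\<close> is an affine function
  of \<open>(g\<^sub>1, g\<^sub>2)\<close> with constant coefficients. Equality of mixed derivatives yields affine relations between
  \<open>g\<^sub>1\<close> and \<open>g\<^sub>2\<close>, and a relation can be differentiated to give others. Two independent relations force
  \<open>f\<close> to be \<open>\<gamma> ln x\<^sup>1\<close> up to a constant. Outside Type A, if there are never two, the coefficients are so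
  restricted that some \<open>\<gamma> ln x\<^sup>1\<close> is a soliton as well. After a shear with \<open>C\<^sub>1\<^sub>2\<^sup>1 = 0\<close> and
  \<open>C\<^sub>2\<^sub>2\<^sup>1 = \<plusminus>1\<close>, or with \<open>C\<^sub>1\<^sub>1\<^sup>1 = 0\<close>, \<open>C\<^sub>1\<^sub>2\<^sup>1 = 1\<close> and \<open>C\<^sub>2\<^sub>2\<^sup>1 = 0\<close>, solvability by \<open>\<gamma> ln x\<^sup>1\<close>
  is exactly the equation of the two normal forms, the parameter \<open>a\<close> being \<open>\<gamma>\<close>.

  For Type A, a chart with constant Christoffel symbols \<open>A\<close> can be normalised at a point so that the
  Ricci tensor and its covariant derivative have the same components there for \<open>A\<close> and for \<open>C\<close>.
  A nondegenerate Ricci tensor would be a flat metric, being constant in the chart; as it is also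
  \<open>(x\<^sup>1)\<^sup>-\<^sup>2\<close> times a constant, this forces its \<open>22\<close> component to vanish, and then the remaining
  equations are contradictory. In rank one the comparison gives \<open>C\<^sub>1\<^sub>2\<^sup>1 = C\<^sub>2\<^sub>2\<^sup>1 = C\<^sub>2\<^sub>2\<^sup>2 = 0\<close>.
\<close>

subsection \<open>Partial derivatives in the plane\<close>

text \<open>The mean value theorem in direction \<open>h\<close>, applied to the difference in
  direction \<open>k\<close>, turns the second difference into \<open>t\<close> times an increment
  of the first derivative \<open>F' _ h\<close>. Differentiability of that derivative at the single
  point \<open>p\<close> then controls the increment up to o(t).\<close>

lemma second_difference_tendsto:
  fixes F :: "'a::real_normed_vector \<Rightarrow> real"
  assumes S: "open S" "p \<in> S"
    and F: "\<And>q. q \<in> S \<Longrightarrow> (F has_derivative F' q) (at q)"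
    and G: "((\<lambda>q. F' q h) has_derivative G) (at p)"
  shows "((\<lambda>t. (F (p + t *\<^sub>R h + t *\<^sub>R k) - F (p + t *\<^sub>R h) - F (p + t *\<^sub>R k) + F p) / t\<^sup>2)
    \<longlongrightarrow> G k) (at_right 0)"
proof (rule tendstoI)
  fix e :: real assume e: "e > 0"
  \<comment> \<open>\<open>t * M\<close> bounds every displacement
    \<open>s *\<^sub>R h + r *\<^sub>R k\<close> with \<open>s\<close> and \<open>r\<close> between
    0 and \<open>t\<close>; \<open>e'\<close> is chosen so that the two error terms below add up to
    \<open>t * (e / 2)\<close>.\<close>
  define M where "M = norm h + norm k + 1"
  have M: "M > 0" "norm h \<le> M" "norm k \<le> M" "norm h + norm k \<le> M"
    by (auto simp: M_def add_nonneg_pos)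
  define e' where "e' = e / (4 * M)"
  have e': "e' > 0" using e M by (simp add: e'_def)
  interpret G: bounded_linear G using G by (rule has_derivative_bounded_linear)
  obtain d1 where d1: "d1 > 0"
    "\<And>y. norm (y - p) < d1 \<Longrightarrow> \<bar>F' y h - F' p h - G (y - p)\<bar> \<le> e' * norm (y - p)"
    using G e' unfolding has_derivative_at_alt by (metis real_norm_def)
  obtain d2 where d2: "d2 > 0" "ball p d2 \<subseteq> S" using S openE by blast
  define d where "d = min d1 d2 / M"
  have d: "d > 0" using d1 d2 M by (simp add: d_def)
  have "dist ((F (p + t *\<^sub>R h + t *\<^sub>R k) - F (p + t *\<^sub>R h) - F (p + t *\<^sub>R k) + F p) / t\<^sup>2) (G k) < e"
    if t: "0 < t" "t < d" for t
  proof -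
    have tM: "t * M < d1" "t * M < d2" using t M by (auto simp: d_def field_simps)
    have small: "norm (s *\<^sub>R h + r *\<^sub>R k) \<le> t * M" if "0 \<le> s" "s \<le> t" "0 \<le> r" "r \<le> t" for s r
    proof -
      have "norm (s *\<^sub>R h + r *\<^sub>R k) \<le> s * norm h + r * norm k"
        using norm_triangle_ineq[of "s *\<^sub>R h" "r *\<^sub>R k"] that by simp
      also have "\<dots> \<le> t * norm h + t * norm k"
        using that by (intro add_mono mult_right_mono) auto
      also have "\<dots> \<le> t * M" using M t by (simp add: distrib_left[symmetric])
      finally show ?thesis .
    qed
    have dist_p: "dist p (p + w) = norm w" for w by (simp add: dist_norm)
    have inS: "p + s *\<^sub>R h + r *\<^sub>R k \<in> S" if "0 \<le> s" "s \<le> t" "0 \<le> r" "r \<le> t" for s r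
    proof -
      have "dist p (p + (s *\<^sub>R h + r *\<^sub>R k)) < d2"
        using small[OF that] tM(2) dist_p[of "s *\<^sub>R h + r *\<^sub>R k"] by linarith
      then show ?thesis using d2(2) by (auto simp: add.assoc)
    qed
    \<comment> \<open>The vanishing displacement is kept as \<open>0 *\<^sub>R k\<close>, so that
      \<open>F1\<close> differentiates both terms, with \<open>r = t\<close> and
      \<open>r = 0\<close>.\<close>
    define \<phi> where "\<phi> s = F (p + s *\<^sub>R h + t *\<^sub>R k) - F (p + s *\<^sub>R h + 0 *\<^sub>R k)" for s
    define D where "D s = F' (p + s *\<^sub>R h + t *\<^sub>R k) h - F' (p + s *\<^sub>R h + 0 *\<^sub>R k) h" for s
    have F1: "((\<lambda>s. F (p + s *\<^sub>R h + r *\<^sub>R k)) has_real_derivative F' (p + s *\<^sub>R h + r *\<^sub>R k) h) (at s)"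
      if "0 \<le> s" "s \<le> t" "0 \<le> r" "r \<le> t" for s r
    proof -
      have lin: "linear (F' (p + s *\<^sub>R h + r *\<^sub>R k))"
        using F[OF inS[OF that]] by (rule has_derivative_linear)
      have "((\<lambda>s. F (p + s *\<^sub>R h + r *\<^sub>R k)) has_derivative
              (\<lambda>x. F' (p + s *\<^sub>R h + r *\<^sub>R k) (x *\<^sub>R h))) (at s)"
        by (rule has_derivative_compose[where f="\<lambda>s. p + s *\<^sub>R h + r *\<^sub>R k", OF _ F[OF inS[OF that]]])
           (auto intro!: derivative_eq_intros)
      then show ?thesis
        by (simp add: has_field_derivative_def linear_cmul[OF lin] mult.commute[of _ "F' _ _"])
    qed
    have "(\<phi> has_real_derivative D s) (at s)" if "0 \<le> s" "s \<le> t" for s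
      unfolding \<phi>_def D_def using that t by (intro DERIV_diff F1) auto
    then obtain z where z: "z > 0" "z < t" "\<phi> t - \<phi> 0 = (t - 0) * D z"
      using MVT2[of 0 t \<phi> D] t by auto
    have *: "\<bar>F' (p + z *\<^sub>R h + r *\<^sub>R k) h - F' p h - G (z *\<^sub>R h + r *\<^sub>R k)\<bar> \<le> e' * (t * M)"
      if "0 \<le> r" "r \<le> t" for r
    proof -
      have n: "norm (z *\<^sub>R h + r *\<^sub>R k) \<le> t * M" using small z that by auto
      have "\<bar>F' (p + z *\<^sub>R h + r *\<^sub>R k) h - F' p h - G (z *\<^sub>R h + r *\<^sub>R k)\<bar>
          \<le> e' * norm (z *\<^sub>R h + r *\<^sub>R k)"
        using d1(2)[of "p + z *\<^sub>R h + r *\<^sub>R k"] n tM by (simp add: add.assoc)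
      also have "\<dots> \<le> e' * (t * M)" using n e' by (simp add: mult_left_mono)
      finally show ?thesis .
    qed
    have "\<bar>D z - t * G k\<bar> \<le> 2 * (e' * (t * M))"
      using *[of t] *[of 0] t by (simp add: D_def G.add G.scaleR)
    also have "\<dots> = t * (e / 2)" using M by (simp add: e'_def)
    also have "\<dots> < t * e" using t e by simp
    finally have "\<bar>D z - t * G k\<bar> < t * e" .
    then have "\<bar>D z / t - G k\<bar> < e"
      using t by (simp add: field_simps abs_if split: if_splits)
    moreover have "F (p + t *\<^sub>R h + t *\<^sub>R k) - F (p + t *\<^sub>R h) - F (p + t *\<^sub>R k) + F p = t * D z"
      using z(3) unfolding \<phi>_def by simp
    ultimately show ?thesis using t by (simp add: dist_norm power2_eq_square)
  qed
  then show "eventually (\<lambda>t. dist ((F (p + t *\<^sub>R h + t *\<^sub>R k) - F (p + t *\<^sub>R h)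
      - F (p + t *\<^sub>R k) + F p) / t\<^sup>2) (G k) < e) (at_right 0)"
    unfolding eventually_at_right_field by (intro exI[of _ d] conjI d) simp
qed

text \<open>The second difference is symmetric in \<open>h\<close> and \<open>k\<close>, so its two
  limits agree.\<close>

lemma mixed_derivatives_commute:
  fixes F :: "'a::real_normed_vector \<Rightarrow> real"
  assumes "open S" "p \<in> S"
    and "\<And>q. q \<in> S \<Longrightarrow> (F has_derivative F' q) (at q)"
    and "((\<lambda>q. F' q h) has_derivative G) (at p)"
    and "((\<lambda>q. F' q k) has_derivative H) (at p)"
  shows "G k = H h"
proof -
  have "((\<lambda>t. (F (p + t *\<^sub>R h + t *\<^sub>R k) - F (p + t *\<^sub>R h) - F (p + t *\<^sub>R k) + F p) / t\<^sup>2)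
    \<longlongrightarrow> G k) (at_right 0)"
    by (rule second_difference_tendsto) (use assms in auto)
  moreover have "((\<lambda>t. (F (p + t *\<^sub>R k + t *\<^sub>R h) - F (p + t *\<^sub>R k) - F (p + t *\<^sub>R h) + F p) / t\<^sup>2)
    \<longlongrightarrow> H h) (at_right 0)"
    by (rule second_difference_tendsto) (use assms in auto)
  ultimately show ?thesis
    by (intro tendsto_unique[OF trivial_limit_at_right_real]) (auto simp: algebra_simps)
qed

text \<open>Total differentiability, with the derivative encoded by its two partial derivatives; it
  is stronger than their mere existence.\<close>

definition has_partials :: "(point \<Rightarrow> real) \<Rightarrow> real \<Rightarrow> real \<Rightarrow> point \<Rightarrow> bool" where
  "has_partials f a b p \<longleftrightarrow> (f has_derivative (\<lambda>h. h $ 1 * a + h $ 2 * b)) (at p)"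

lemma has_partials_unique:
  assumes "has_partials f a b p" "has_partials f c d p"
  shows "a = c" "b = d"
proof -
  have *: "(\<lambda>h::point. h $ 1 * a + h $ 2 * b) = (\<lambda>h. h $ 1 * c + h $ 2 * d)"
    using assms unfolding has_partials_def by (rule has_derivative_unique)
  show "a = c" using fun_cong[OF *, of "axis 1 1"] by (simp add: axis_def)
  show "b = d" using fun_cong[OF *, of "axis 2 1"] by (simp add: axis_def)
qed

lemma has_partials_cong:
  assumes "has_partials f a b p" "open S" "p \<in> S" "\<And>q. q \<in> S \<Longrightarrow> f q = g q"
  shows "has_partials g a b p"
  using assms unfolding has_partials_def by (rule has_derivative_transform_within_open)

lemma has_partials_const: "a = 0 \<Longrightarrow> b = 0 \<Longrightarrow> has_partials (\<lambda>_. c) a b p"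
  by (simp add: has_partials_def)

lemma has_partials_nth_1: "a = 1 \<Longrightarrow> b = 0 \<Longrightarrow> has_partials (\<lambda>p. p $ 1) a b p"
  and has_partials_nth_2: "a = 0 \<Longrightarrow> b = 1 \<Longrightarrow> has_partials (\<lambda>p. p $ 2) a b p"
  unfolding has_partials_def
  by (auto intro: bounded_linear.has_derivative[OF bounded_linear_vec_nth has_derivative_ident])

lemma has_partials_add:
  assumes "has_partials f a b p" "has_partials g c d p" "a' = a + c" "b' = b + d"
  shows "has_partials (\<lambda>p. f p + g p) a' b' p"
  using assms unfolding has_partials_def
  by (auto intro!: derivative_eq_intros simp: algebra_simps)

lemma has_partials_diff:
  assumes "has_partials f a b p" "has_partials g c d p" "a' = a - c" "b' = b - d"
  shows "has_partials (\<lambda>p. f p - g p) a' b' p"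
  using assms unfolding has_partials_def
  by (auto intro!: derivative_eq_intros simp: algebra_simps)

lemma has_partials_uminus:
  assumes "has_partials f a b p" "a' = - a" "b' = - b"
  shows "has_partials (\<lambda>p. - f p) a' b' p"
  using assms unfolding has_partials_def
  by (auto intro!: derivative_eq_intros simp: algebra_simps)

lemma has_partials_mult:
  assumes "has_partials f a b p" "has_partials g c d p"
    "a' = a * g p + f p * c" "b' = b * g p + f p * d"
  shows "has_partials (\<lambda>p. f p * g p) a' b' p"
  using assms unfolding has_partials_def
  by (auto intro!: derivative_eq_intros simp: algebra_simps)

lemma has_partials_compose:
  assumes "has_partials f a b p" "(g has_real_derivative D) (at (f p))" "a' = D * a" "b' = D * b"
  shows "has_partials (\<lambda>p. g (f p)) a' b' p"
  using has_derivative_compose[OF assms(1)[unfolded has_partials_def]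
      assms(2)[unfolded has_field_derivative_def]] assms(3,4)
  by (simp add: has_partials_def algebra_simps)

lemma has_partials_divide:
  assumes "has_partials f a b p" "has_partials g c d p" "g p \<noteq> 0"
    "a' = (a * g p - f p * c) / (g p)\<^sup>2" "b' = (b * g p - f p * d) / (g p)\<^sup>2"
  shows "has_partials (\<lambda>p. f p / g p) a' b' p"
proof -
  have "has_partials (\<lambda>p. inverse (g p)) (- (inverse (g p))\<^sup>2 * c) (- (inverse (g p))\<^sup>2 * d) p"
    by (rule has_partials_compose[OF assms(2)])
       (use assms(3) in \<open>auto intro!: derivative_eq_intros simp: power2_eq_square\<close>)
  then show ?thesis
    unfolding divide_inverse
    by (rule has_partials_mult[OF assms(1)])
       (use assms(3-5) in \<open>simp_all add: field_simps power2_eq_square\<close>)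
qed

text \<open>Here \<open>b\<close> is the second partial derivative of \<open>F1\<close> and
  \<open>c\<close> the first of \<open>F2\<close>. Every integrability condition below comes from
  this equality.\<close>

lemma has_partials_commute:
  assumes "open S" "p \<in> S" "\<And>q. q \<in> S \<Longrightarrow> has_partials F (F1 q) (F2 q) q"
    and "has_partials F1 a b p" "has_partials F2 c d p"
  shows "b = c"
proof -
  have *: "axis 1 1 $ 1 = (1::real)" "axis 1 1 $ (2::2) = (0::real)"
    "axis 2 1 $ (1::2) = (0::real)" "axis 2 1 $ 2 = (1::real)"
    by (auto simp: axis_def)
  show ?thesis
    using mixed_derivatives_commute[of S p F "\<lambda>q h. h $ 1 * F1 q + h $ 2 * F2 q" "axis 1 1"
      "\<lambda>h. h $ 1 * a + h $ 2 * b" "axis 2 1" "\<lambda>h. h $ 1 * c + h $ 2 * d",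
      OF assms(1,2) assms(3)[unfolded has_partials_def]] assms(4,5)
    by (simp only: has_partials_def *) simp
qed

lemma vec2_expand: "(h :: real^2) = h $ 1 *\<^sub>R axis 1 1 + h $ 2 *\<^sub>R axis 2 1"
  by (simp add: vec_eq_iff forall_2 axis_def)

lemma linear_vec2:
  assumes "linear (L :: real^2 \<Rightarrow> 'b::real_vector)"
  shows "L h = h $ 1 *\<^sub>R L (axis 1 1) + h $ 2 *\<^sub>R L (axis 2 1)"
  by (subst vec2_expand[of h]) (simp add: linear_add[OF assms] linear_cmul[OF assms])

lemma has_partials_component:
  fixes f :: "point \<Rightarrow> real^2"
  assumes "(f has_derivative f') (at p)"
  shows "has_partials (\<lambda>q. f q $ k) (f' (axis 1 1) $ k) (f' (axis 2 1) $ k) p"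
proof -
  have "((\<lambda>q. f q $ k) has_derivative (\<lambda>h. f' h $ k)) (at p)"
    using assms by (rule bounded_linear.has_derivative[OF bounded_linear_vec_nth])
  moreover have "(\<lambda>h. f' h $ k) = (\<lambda>h. h $ 1 * f' (axis 1 1) $ k + h $ 2 * f' (axis 2 1) $ k)"
    by (rule ext, subst linear_vec2[OF has_derivative_linear[OF assms]]) simp
  ultimately show ?thesis by (simp add: has_partials_def)
qed

lemma has_derivative_vec2I:
  fixes f :: "point \<Rightarrow> real^2"
  assumes "has_partials (\<lambda>q. f q $ 1) a b p" "has_partials (\<lambda>q. f q $ 2) c d p"
  shows "(f has_derivative (\<lambda>h. vector [h $ 1 * a + h $ 2 * b, h $ 1 * c + h $ 2 * d])) (at p)"
proof -
  have "((\<lambda>q. f q $ 1 *\<^sub>R axis 1 1 + f q $ 2 *\<^sub>R (axis 2 1 :: real^2)) has_derivative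
     (\<lambda>h. (h $ 1 * a + h $ 2 * b) *\<^sub>R axis 1 1 + (h $ 1 * c + h $ 2 * d) *\<^sub>R axis 2 1)) (at p)"
    using assms unfolding has_partials_def by (auto intro!: derivative_eq_intros)
  moreover have "vector [x, y] = x *\<^sub>R axis 1 1 + y *\<^sub>R (axis 2 1 :: real^2)" for x y
    by (simp add: vec_eq_iff forall_2 axis_def)
  ultimately show ?thesis by (simp add: vec2_expand[symmetric])
qed

section \<open>Smooth functions on open sets\<close>

lemma smooth_on_imp_differentiable:
  assumes "smooth_on S f" "open S" "p \<in> S"
  shows "f differentiable (at p)"
proof -
  have "Ck_on (Suc 0) S f" using assms(1) unfolding smooth_on_def by (rule spec)
  then have "f differentiable_on S" unfolding Ck_on.simps by (rule conjunct1)
  then show ?thesis using assms(2,3) by (metis differentiable_on_def at_within_open)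
qed

lemma smooth_on_partial:
  assumes "smooth_on S f"
  shows "smooth_on S (\<lambda>p. frechet_derivative f (at p) (axis i 1))"
  unfolding smooth_on_def
proof
  fix n
  have "Ck_on (Suc n) S f" using assms unfolding smooth_on_def by (rule spec)
  then show "Ck_on n S (\<lambda>p. frechet_derivative f (at p) (axis i 1))"
    unfolding Ck_on.simps(2) by blast
qed

lemma smooth_on_has_partials:
  assumes "smooth_on S f" "open S" "p \<in> S"
  shows "has_partials f (frechet_derivative f (at p) (axis 1 1)) (frechet_derivative f (at p) (axis 2 1)) p"
proof -
  have d: "(f has_derivative frechet_derivative f (at p)) (at p)"
    using smooth_on_imp_differentiable[OF assms] by (simp only: frechet_derivative_works)
  have "frechet_derivative f (at p) = (\<lambda>h. h $ 1 * frechet_derivative f (at p) (axis 1 1)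
      + h $ 2 * frechet_derivative f (at p) (axis 2 1))"
    by (rule ext, subst linear_vec2[OF has_derivative_linear[OF d]]) simp
  with d show ?thesis unfolding has_partials_def by (rule subst[rotated])
qed

text \<open>On an open set, agreement of two functions passes to their derivatives, which carries
  the induction on the order.\<close>

lemma Ck_on_cong:
  assumes "open S" "\<And>p. p \<in> S \<Longrightarrow> f p = g p" "Ck_on n S f"
  shows "Ck_on n S g"
  using assms(2,3)
proof (induction n arbitrary: f g)
  case 0
  have "continuous_on S f = continuous_on S g" by (rule continuous_on_cong) (use 0 in auto)
  with 0 show ?case by simp
next
  case (Suc n)
  have "f differentiable (at p)" if "p \<in> S" for p
    using Suc.prems(2) that assms(1) unfolding Ck_on.simps(2)
    by (metis differentiable_on_def at_within_open)
  then have d: "(f has_derivative frechet_derivative f (at p)) (at p)" if "p \<in> S" for p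
    using that by (simp only: frechet_derivative_works)
  then have d': "(g has_derivative frechet_derivative f (at p)) (at p)" if "p \<in> S" for p
    using has_derivative_transform_within_open[OF _ assms(1)] Suc.prems(1) that by blast
  have eq: "frechet_derivative f (at p) = frechet_derivative g (at p)" if "p \<in> S" for p
    using frechet_derivative_at[OF d'[OF that]] .
  have "g differentiable_on S"
    using d' by (meson differentiable_at_imp_differentiable_on differentiable_def)
  moreover have "Ck_on n S (\<lambda>p. frechet_derivative g (at p) (axis i 1))" for i
    by (rule Suc.IH[of "\<lambda>p. frechet_derivative f (at p) (axis i 1)"])
       (use Suc.prems(2) eq in \<open>simp_all only: Ck_on.simps(2)\<close>)
  ultimately show ?case unfolding Ck_on.simps(2) by blast
qed

subsection \<open>Curvature of Type B connections\<close>

lemma has_partials_eqI: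
  "has_partials f a b p \<Longrightarrow> a = a' \<Longrightarrow> b = b' \<Longrightarrow> has_partials f a' b' p"
  by simp

text \<open>With \<open>refl\<close> for the side equations these rules compute the partial
  derivatives into schematic variables; a preceding \<open>has_partials_eqI\<close> leaves only the
  comparison with the expected values.\<close>

lemmas has_partials_raw_intros =
  has_partials_const[OF refl refl] has_partials_nth_1[OF refl refl] has_partials_nth_2[OF refl refl]
  has_partials_add[OF _ _ refl refl] has_partials_diff[OF _ _ refl refl]
  has_partials_uminus[OF _ refl refl] has_partials_mult[OF _ _ refl refl]
  has_partials_divide[OF _ _ _ refl refl]

lemma frechet_derivative_nth:
  fixes Y :: "point \<Rightarrow> real^2"
  assumes "\<And>k. has_partials (\<lambda>q. Y q $ k) (Y1 k) (Y2 k) p"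
  shows "frechet_derivative Y (at p) h $ k = h $ 1 * Y1 k + h $ 2 * Y2 k"
proof -
  have "(\<lambda>h. vector [h $ 1 * Y1 1 + h $ 2 * Y2 1, h $ 1 * Y1 2 + h $ 2 * Y2 2]) = frechet_derivative Y (at p)"
    by (rule frechet_derivative_at[OF has_derivative_vec2I]) (rule assms)+
  then show ?thesis using exhaust_2[of k]
    by (auto simp: fun_eq_iff dest!: spec[of _ h] sym[of _ "frechet_derivative Y (at p) h"])
qed

lemma cov_nth:
  fixes Y :: vfield
  assumes "\<And>k. has_partials (\<lambda>q. Y q $ k) (Y1 k) (Y2 k) p"
  shows "cov \<Gamma> X Y p $ k = X p $ 1 * Y1 k + X p $ 2 * Y2 k
    + (\<Sum>i\<in>UNIV. \<Sum>j\<in>UNIV. X p $ i * Y p $ j * \<Gamma> p i j k)"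
  unfolding cov_def using frechet_derivative_nth[of Y Y1 Y2 p "X p" k, OF assms] by simp

lemma coord_field_nth: "coord_field i p $ k = (if k = i then 1 else 0)"
  by (simp add: coord_field_def axis_def)

lemma cov_coord_coord: "cov \<Gamma> (coord_field i) (coord_field j) p $ k = \<Gamma> p i j k"
  using exhaust_2[of i] exhaust_2[of j]
  by (subst cov_nth[where ?Y1.0="\<lambda>_. 0" and ?Y2.0="\<lambda>_. 0"])
     (auto simp: coord_field_nth sum_2 intro: has_partials_const)

text \<open>Covariant derivatives of coordinate fields along each other have components of the form
  constant over \<open>x\<^sup>1\<close>, so the curvature requires only fields \<open>Y\<close> of
  this shape. The term \<open>- D k\<close> is the derivative of
  \<open>1 / x\<^sup>1\<close>.\<close>

lemma cov_coord_type_B: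
  assumes "p \<in> half_plane" and Y: "\<And>q k. Y q $ k = D k / q $ 1"
  shows "cov (type_B_connection C) (coord_field i) Y p $ k =
    ((\<Sum>m\<in>UNIV. D m * C i m k) - (if i = 1 then D k else 0)) / (p $ 1)\<^sup>2"
proof -
  have p: "p $ 1 > 0" using assms(1) by (simp add: half_plane_def)
  have "has_partials (\<lambda>q. Y q $ k) (- D k / (p $ 1)\<^sup>2) 0 p" for k
    unfolding Y using p by - (rule has_partials_eqI, (rule has_partials_raw_intros | (simp; fail))+)
  then show ?thesis
    using p exhaust_2[of i]
    by (subst cov_nth) (auto simp: coord_field_nth sum_2 type_B_connection_def Y
        power2_eq_square field_simps)
qed

lemma curvature_type_B:
  assumes "p \<in> half_plane"
  shows "curvature (type_B_connection C) (coord_field i) (coord_field j) (coord_field k) p $ l =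
    ((\<Sum>m\<in>UNIV. C j k m * C i m l - C i k m * C j m l)
      - (if i = 1 then C j k l else 0) + (if j = 1 then C i k l else 0)) / (p $ 1)\<^sup>2"
proof -
  have "bracket (coord_field i) (coord_field j) = (\<lambda>p. 0)"
    by (simp add: bracket_def coord_field_def)
  moreover have "cov (type_B_connection C) (\<lambda>p. 0) (coord_field k) p $ l = 0"
    by (simp add: cov_def coord_field_def)
  moreover have Y: "cov (type_B_connection C) (coord_field i) (coord_field j) q $ k = C i j k / q $ 1"
    for q i j k by (simp add: cov_coord_coord type_B_connection_def)
  ultimately show ?thesis unfolding curvature_def
    by (simp add: cov_coord_type_B[OF assms Y] sum_subtractf diff_divide_distrib add_divide_distrib)
qed

text \<open>The constants left when the Ricci tensor is multiplied by the square of
  \<open>x\<^sup>1\<close>. They need not be symmetric in \<open>j\<close> and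
  \<open>k\<close>.\<close>

definition ricci_coeff :: "coeffs \<Rightarrow> 2 \<Rightarrow> 2 \<Rightarrow> real" where
  "ricci_coeff C j k = (\<Sum>i\<in>UNIV. (\<Sum>m\<in>UNIV. C j k m * C i m i - C i k m * C j m i)
      - (if i = 1 then C j k i else 0) + (if j = 1 then C i k i else 0))"

lemma ricci_type_B:
  assumes "p \<in> half_plane"
  shows "ricci (type_B_connection C) (coord_field j) (coord_field k) p = ricci_coeff C j k / (p $ 1)\<^sup>2"
  by (simp add: ricci_def ricci_coeff_def curvature_type_B[OF assms] sum_divide_distrib)

lemma ricci_coeff_eqs:
  assumes "\<And>i j k. C i j k = C j i k"
  shows "ricci_coeff C 1 1 = C 1 2 2 + C 1 1 1 * C 1 2 2 + C 1 1 2 * C 2 2 2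
           - C 1 1 2 * C 1 2 1 - (C 1 2 2)\<^sup>2"
    and "ricci_coeff C 1 2 = C 2 2 2 + C 1 2 1 * C 1 2 2 - C 1 1 2 * C 2 2 1"
    and "ricci_coeff C 2 1 = - C 1 2 1 + C 1 2 1 * C 1 2 2 - C 1 1 2 * C 2 2 1"
    and "ricci_coeff C 2 2 = - C 2 2 1 + C 1 1 1 * C 2 2 1 - C 1 2 2 * C 2 2 1
           + C 1 2 1 * C 2 2 2 - (C 1 2 1)\<^sup>2"
  using assms[of 2 1 1] assms[of 2 1 2]
  by (simp_all add: ricci_coeff_def sum_2 power2_eq_square algebra_simps)

text \<open>In dimension two the Ricci tensor determines the curvature.\<close>

lemma flat_on_if_ricci_coeff_0:
  assumes "\<And>i j k. C i j k = C j i k" "\<And>j k. ricci_coeff C j k = 0"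
  shows "flat_on half_plane (type_B_connection C)"
proof -
  have "curvature (type_B_connection C) (coord_field i) (coord_field j) (coord_field k) p $ l = 0"
    if "p \<in> half_plane" for p i j k l
    using exhaust_2[of i] exhaust_2[of j] exhaust_2[of k] exhaust_2[of l]
      assms(2)[of 1 1] assms(2)[of 1 2] assms(2)[of 2 1] assms(2)[of 2 2] 
      assms(1)[of 2 1 1] assms(1)[of 2 1 2]
    unfolding curvature_type_B[OF that] ricci_coeff_eqs[OF assms(1)]
    by (auto simp: sum_2 power2_eq_square algebra_simps)
  then show ?thesis by (simp add: flat_on_def vec_eq_iff)
qed

lemma hessian_type_B:
  assumes "smooth_on half_plane f" "p \<in> half_plane"
  shows "hessian (type_B_connection C) f (coord_field i) (coord_field j) p =
    frechet_derivative (\<lambda>q. frechet_derivative f (at q) (axis j 1)) (at p) (axis i 1)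
    - (\<Sum>k\<in>UNIV. C i j k * frechet_derivative f (at p) (axis k 1)) / p $ 1"
proof -
  have "open half_plane" unfolding half_plane_def by (intro open_Collect_less continuous_intros)
  with assms have lin: "linear (frechet_derivative f (at p))"
    by (intro linear_frechet_derivative smooth_on_imp_differentiable)
  define X where "X = cov (type_B_connection C) (coord_field i) (coord_field j) p"
  have X: "X $ k = C i j k / p $ 1" for k
    by (simp add: X_def cov_coord_coord type_B_connection_def)
  have "frechet_derivative f (at p) X
      = (\<Sum>k\<in>UNIV. C i j k * frechet_derivative f (at p) (axis k 1)) / p $ 1"
    by (subst linear_vec2[OF lin]) (simp add: X sum_2 add_divide_distrib)
  then show ?thesis by (simp add: hessian_def X_def[symmetric]) (simp add: coord_field_def)
qed

definition sym_ricci_coeff :: "coeffs \<Rightarrow> 2 \<Rightarrow> 2 \<Rightarrow> real" where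
  "sym_ricci_coeff C i j = (ricci_coeff C i j + ricci_coeff C j i) / 2"

lemma solitons_type_B_iff:
  "f \<in> solitons half_plane (type_B_connection C) \<longleftrightarrow> smooth_on half_plane f \<and>
    (\<forall>p\<in>half_plane. \<forall>i j.
      frechet_derivative (\<lambda>q. frechet_derivative f (at q) (axis j 1)) (at p) (axis i 1)
      = (\<Sum>k\<in>UNIV. C i j k * frechet_derivative f (at p) (axis k 1)) / p $ 1
        - sym_ricci_coeff C i j / (p $ 1)\<^sup>2)"
proof -
  have "hessian (type_B_connection C) f (coord_field i) (coord_field j) p
      + ricci_sym (type_B_connection C) (coord_field i) (coord_field j) p = 0 \<longleftrightarrow>
      frechet_derivative (\<lambda>q. frechet_derivative f (at q) (axis j 1)) (at p) (axis i 1)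
      = (\<Sum>k\<in>UNIV. C i j k * frechet_derivative f (at p) (axis k 1)) / p $ 1
        - sym_ricci_coeff C i j / (p $ 1)\<^sup>2"
    if "smooth_on half_plane f" "p \<in> half_plane" for p i j
    unfolding hessian_type_B[OF that] ricci_sym_def ricci_type_B[OF that(2)] sym_ricci_coeff_def
    by (simp add: add_divide_distrib) argo
  then show ?thesis unfolding solitons_def by blast
qed

subsection \<open>Charts with constant Christoffel symbols\<close>

lemma open_half_plane: "open half_plane"
  unfolding half_plane_def by (intro open_Collect_less continuous_intros)

text \<open>\<open>chart\<close> states that \<psi> undoes \<phi> on \<open>U\<close>. Hence \<phi>
  also undoes \<psi> on the open image of \<open>U\<close>, and this identity can be differentiated
  there.\<close>

lemma chart_inverse_derivative:
  assumes "chart U \<phi> \<psi>" "p \<in> U"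
  shows "frechet_derivative \<phi> (at p) (frechet_derivative \<psi> (at (\<phi> p)) h) = h"
proof -
  have c: "open U" "open (\<phi> ` U)" "smooth_on U \<phi>" "smooth_on (\<phi> ` U) \<psi>" "\<And>p. p \<in> U \<Longrightarrow> \<psi> (\<phi> p) = p"
    using assms(1) by (auto simp: chart_def)
  have d\<phi>: "(\<phi> has_derivative frechet_derivative \<phi> (at p)) (at (\<psi> (\<phi> p)))"
    using smooth_on_imp_differentiable[OF c(3,1) assms(2)] c(5)[OF assms(2)]
    by (simp only: frechet_derivative_works)
  have d\<psi>: "(\<psi> has_derivative frechet_derivative \<psi> (at (\<phi> p))) (at (\<phi> p))"
    using smooth_on_imp_differentiable[OF c(4,2)] assms(2) by (simp only: frechet_derivative_works imageI)
  have "((\<lambda>y. \<phi> (\<psi> y)) has_derivative (\<lambda>h. frechet_derivative \<phi> (at p)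
      (frechet_derivative \<psi> (at (\<phi> p)) h))) (at (\<phi> p))"
    by (rule has_derivative_compose[OF d\<psi> d\<phi>])
  moreover have "((\<lambda>y. \<phi> (\<psi> y)) has_derivative (\<lambda>h. h)) (at (\<phi> p))"
    by (rule has_derivative_transform_within_open[OF has_derivative_ident c(2)])
       (use assms(2) c(5) in auto)
  ultimately show ?thesis by (metis has_derivative_unique)
qed

text \<open>Everything is expressed in the chart coordinates \<open>y\<close>: \<Psi> gives the
  original coordinates as functions of \<open>y\<close>, and \<open>X j k\<close> is the component
  \<open>k\<close> of the field of partial differentiation by the chart coordinate \<open>j\<close>.
  The definition of the Christoffel symbols then becomes a first order system for \<Psi> and
  \<open>X\<close>.\<close>

lemma chart_frame_system:
  assumes ch: "chart U \<phi> \<psi>" and p0: "p0 \<in> U" and U: "U \<subseteq> half_plane"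
    and cc: "christoffel_in_chart (type_B_connection C) U \<phi> \<psi> (\<lambda>_. A)"
  obtains V y0 and \<Psi> :: "2 \<Rightarrow> point \<Rightarrow> real" and X :: "2 \<Rightarrow> 2 \<Rightarrow> point \<Rightarrow> real"
  where "open V" "y0 \<in> V"
    "\<And>y. y \<in> V \<Longrightarrow> \<Psi> 1 y > 0"
    "\<And>y k. y \<in> V \<Longrightarrow> has_partials (\<Psi> k) (X 1 k y) (X 2 k y) y"
    "\<And>y j k. y \<in> V \<Longrightarrow> has_partials (X j k)
       ((\<Sum>l\<in>UNIV. A 1 j l * X l k y)
          - (\<Sum>l\<in>UNIV. \<Sum>m\<in>UNIV. X 1 l y * X j m y * C l m k) / \<Psi> 1 y)
       ((\<Sum>l\<in>UNIV. A 2 j l * X l k y)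
          - (\<Sum>l\<in>UNIV. \<Sum>m\<in>UNIV. X 2 l y * X j m y * C l m k) / \<Psi> 1 y) y"
    "\<And>y. y \<in> V \<Longrightarrow> X 1 1 y * X 2 2 y - X 1 2 y * X 2 1 y \<noteq> 0"
proof -
  have c: "open U" "open (\<phi> ` U)" "smooth_on U \<phi>" "smooth_on (\<phi> ` U) \<psi>" "\<And>p. p \<in> U \<Longrightarrow> \<psi> (\<phi> p) = p"
    using ch by (auto simp: chart_def)
  define V where "V = \<phi> ` U"
  define Xv where "Xv j y = frechet_derivative \<psi> (at y) (axis j 1)" for j y
  define \<Psi> where "\<Psi> k y = \<psi> y $ k" for k y
  define X where "X j k y = Xv j y $ k" for j k y
  have 1: "open V" "\<phi> p0 \<in> V" using c p0 by (auto simp: V_def)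
  have 2: "\<Psi> 1 y > 0" if "y \<in> V" for y
    using that U c(5) by (auto simp: V_def \<Psi>_def half_plane_def)
  have smX: "smooth_on V (Xv j)" for j
    unfolding Xv_def V_def by (rule smooth_on_partial[OF c(4)])
  have diff: "(f has_derivative frechet_derivative f (at y)) (at y)" if "smooth_on V f" "y \<in> V"
    for f :: "point \<Rightarrow> point" and y
    using smooth_on_imp_differentiable[OF that(1) _ that(2)] c(2)
    by (simp only: frechet_derivative_works V_def)
  have 3: "has_partials (\<Psi> k) (X 1 k y) (X 2 k y) y" if "y \<in> V" for y k
    unfolding \<Psi>_def X_def Xv_def
    by (rule has_partials_component[OF diff]) (use c(4) that in \<open>simp_all add: V_def\<close>)
  \<comment> \<open>The derivative of \<phi> maps the frame field \<open>i\<close> to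
    \<open>axis i 1\<close>, so by the chain rule differentiation along that field in
    \<open>U\<close> is partial differentiation in the chart.\<close>
  have DX: "frechet_derivative (Xv j) (at y) (axis i 1) $ k = (\<Sum>l\<in>UNIV. A i j l * X l k y)
          - (\<Sum>l\<in>UNIV. \<Sum>m\<in>UNIV. X i l y * X j m y * C l m k) / \<Psi> 1 y" if y: "y \<in> V" for y i j k
  proof -
    obtain p where p: "p \<in> U" "y = \<phi> p" using y by (auto simp: V_def)
    then have py: "p = \<psi> y" using c(5) by auto
    have d\<phi>: "(\<phi> has_derivative frechet_derivative \<phi> (at p)) (at p)"
      using smooth_on_imp_differentiable[OF c(3,1) p(1)] by (simp only: frechet_derivative_works)
    have "((\<lambda>q. Xv j (\<phi> q)) has_derivative (\<lambda>h. frechet_derivative (Xv j) (at y)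
        (frechet_derivative \<phi> (at p) h))) (at p)"
      by (rule has_derivative_compose[OF d\<phi>]) (use diff[OF smX y] p in simp)
    then have "frechet_derivative (\<lambda>q. Xv j (\<phi> q)) (at p) (Xv i y)
      = frechet_derivative (Xv j) (at y) (frechet_derivative \<phi> (at p) (Xv i y))"
      by (metis frechet_derivative_at)
    also have "frechet_derivative \<phi> (at p) (Xv i y) = axis i 1"
      unfolding Xv_def p(2) by (rule chart_inverse_derivative[OF ch p(1)])
    finally have *: "frechet_derivative (\<lambda>q. Xv j (\<phi> q)) (at p) (Xv i y)
      = frechet_derivative (Xv j) (at y) (axis i 1)" .
    have fr: "chart_frame \<phi> \<psi> i = (\<lambda>q. Xv i (\<phi> q))" for i
      by (simp add: chart_frame_def Xv_def)
    have "cov (type_B_connection C) (\<lambda>q. Xv i (\<phi> q)) (\<lambda>q. Xv j (\<phi> q)) p $ k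
      = (\<Sum>l\<in>UNIV. A i j l *\<^sub>R Xv l (\<phi> p)) $ k"
      using cc p(1) unfolding christoffel_in_chart_def fr by simp
    then show ?thesis
      by (simp add: cov_def p(2)[symmetric] * type_B_connection_def X_def \<Psi>_def py[symmetric]
          sum_2 add_divide_distrib algebra_simps)
  qed
  have 4: "has_partials (X j k)
       ((\<Sum>l\<in>UNIV. A 1 j l * X l k y)
          - (\<Sum>l\<in>UNIV. \<Sum>m\<in>UNIV. X 1 l y * X j m y * C l m k) / \<Psi> 1 y)
       ((\<Sum>l\<in>UNIV. A 2 j l * X l k y)
          - (\<Sum>l\<in>UNIV. \<Sum>m\<in>UNIV. X 2 l y * X j m y * C l m k) / \<Psi> 1 y) y"
    if "y \<in> V" for y j k
    using has_partials_component[OF diff[OF smX that], of j k] unfolding DX[OF that]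
    by (simp add: X_def[abs_def])
  have 5: "X 1 1 y * X 2 2 y - X 1 2 y * X 2 1 y \<noteq> 0" if y: "y \<in> V" for y
  proof -
    obtain p where p: "p \<in> U" "y = \<phi> p" using y by (auto simp: V_def)
    \<comment> \<open>\<open>L\<close> inverts the derivative of \<psi>, whose matrix is
      \<open>X\<close>; the four product equations below make the determinant of \<open>X\<close>
      nonzero.\<close>
    define L where "L = frechet_derivative \<phi> (at p)"
    have lin: "linear L" unfolding L_def
      using smooth_on_imp_differentiable[OF c(3,1) p(1)] by (rule linear_frechet_derivative)
    have "L (Xv j y) = axis j 1" for j
      unfolding Xv_def p(2) L_def by (rule chart_inverse_derivative[OF ch p(1)])
    then have "(X j 1 y *\<^sub>R L (axis 1 1) + X j 2 y *\<^sub>R L (axis 2 1)) $ k = axis j 1 $ k" for j k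
      unfolding X_def by (subst linear_vec2[OF lin, symmetric]) simp
    note * = this
    have "X 1 1 y * L (axis 1 1) $ 1 + X 1 2 y * L (axis 2 1) $ 1 = 1"
      "X 1 1 y * L (axis 1 1) $ 2 + X 1 2 y * L (axis 2 1) $ 2 = 0"
      "X 2 1 y * L (axis 1 1) $ 1 + X 2 2 y * L (axis 2 1) $ 1 = 0"
      "X 2 1 y * L (axis 1 1) $ 2 + X 2 2 y * L (axis 2 1) $ 2 = 1"
      using *[of 1 1] *[of 1 2] *[of 2 1] *[of 2 2] by (simp_all add: axis_def)
    then show ?thesis by algebra
  qed
  show thesis by (rule that[OF 1 2 3 4 5])
qed

text \<open>The rescaled frame \<open>E = X / x\<^sup>1\<close> satisfies an autonomous system, and a linear change of the
  chart coordinates makes it the identity at one point.\<close>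

lemma normalised_frame_system:
  fixes A C :: coeffs and X :: "2 \<Rightarrow> 2 \<Rightarrow> point \<Rightarrow> real" and \<Psi> :: "2 \<Rightarrow> point \<Rightarrow> real"
  assumes C: "\<And>i j k. C i j k = C j i k"
    and V: "open V" "y0 \<in> V"
    and pos: "\<And>y. y \<in> V \<Longrightarrow> \<Psi> 1 y > 0"
    and d\<Psi>: "\<And>y k. y \<in> V \<Longrightarrow> has_partials (\<Psi> k) (X 1 k y) (X 2 k y) y"
    and dX: "\<And>y j k. y \<in> V \<Longrightarrow> has_partials (X j k)
       ((\<Sum>l\<in>UNIV. A 1 j l * X l k y)
          - (\<Sum>l\<in>UNIV. \<Sum>m\<in>UNIV. X 1 l y * X j m y * C l m k) / \<Psi> 1 y)
       ((\<Sum>l\<in>UNIV. A 2 j l * X l k y)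
          - (\<Sum>l\<in>UNIV. \<Sum>m\<in>UNIV. X 2 l y * X j m y * C l m k) / \<Psi> 1 y) y"
    and det: "\<And>y. y \<in> V \<Longrightarrow> X 1 1 y * X 2 2 y - X 1 2 y * X 2 1 y \<noteq> 0"
  obtains V' z0 and E :: "2 \<Rightarrow> 2 \<Rightarrow> point \<Rightarrow> real" and A' :: coeffs where "open V'" "z0 \<in> V'" "\<And>i j k. A' i j k = A' j i k"
    "\<And>a k. E a k z0 = (if a = k then 1 else 0)"
    "\<And>z a k. z \<in> V' \<Longrightarrow> has_partials (E a k)
      ((\<Sum>l\<in>UNIV. A' 1 a l * E l k z) - (\<Sum>l\<in>UNIV. \<Sum>m\<in>UNIV. E 1 l z * E a m z * C l m k)
        - E 1 1 z * E a k z)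
      ((\<Sum>l\<in>UNIV. A' 2 a l * E l k z) - (\<Sum>l\<in>UNIV. \<Sum>m\<in>UNIV. E 2 l z * E a m z * C l m k)
        - E 2 1 z * E a k z) z"
proof -
  \<comment> \<open>The mixed derivatives of \<Psi> agree and \<open>C\<close> is symmetric, so the
    antisymmetric part of \<open>A\<close> is annihilated by the invertible matrix
    \<open>X\<close>.\<close>
  have A: "A i j k = A j i k" for i j k
  proof -
    have "A 1 2 k = A 2 1 k"
    proof -
      have "(A 1 2 1 - A 2 1 1) * X 1 k y0 + (A 1 2 2 - A 2 1 2) * X 2 k y0 = 0" for k
        using has_partials_commute[OF V d\<Psi> dX[OF V(2)] dX[OF V(2)], of k] C[of 2 1 k]
        by (simp add: sum_2 algebra_simps)
      from this[of 1] this[of 2] det[OF V(2)] have "A 1 2 1 = A 2 1 1 \<and> A 1 2 2 = A 2 1 2"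
        by algebra
      then show ?thesis using exhaust_2[of k] by auto
    qed
    then show ?thesis using exhaust_2[of i] exhaust_2[of j] by auto
  qed
  define D where "D = X 1 1 y0 * X 2 2 y0 - X 1 2 y0 * X 2 1 y0"
  define e where "e a k = X a k y0 / \<Psi> 1 y0" for a k
  \<comment> \<open>\<open>f\<close> is the inverse matrix of \<open>e\<close>, written through the
    adjugate.\<close>
  define f :: "2 \<Rightarrow> 2 \<Rightarrow> real" where "f a k = \<Psi> 1 y0 / D *
    (if a = 1 then (if k = 1 then X 2 2 y0 else - X 1 2 y0)
     else (if k = 1 then - X 2 1 y0 else X 1 1 y0))" for a k
  have D: "D \<noteq> 0" using det[OF V(2)] by (simp add: D_def)
  have p0: "\<Psi> 1 y0 \<noteq> 0" using pos[OF V(2)] by simp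
  have fe: "f a 1 * e 1 k + f a 2 * e 2 k = (if a = k then 1 else 0)" for a k
    using exhaust_2[of a] exhaust_2[of k] D p0
    by (auto simp: f_def e_def field_simps) (auto simp: D_def algebra_simps)
  have ef: "e a 1 * f 1 k + e a 2 * f 2 k = (if a = k then 1 else 0)" for a k
    using exhaust_2[of a] exhaust_2[of k] D p0
    by (auto simp: f_def e_def field_simps) (auto simp: D_def algebra_simps)
  \<comment> \<open>\<open>L\<close> maps the new linear coordinates \<open>z\<close> to
    \<open>y\<close>, and \<open>M\<close> maps back. The new frame is \<open>f\<close> times the
    old one, which becomes the identity at \<open>M y0\<close> after division by
    \<open>x\<^sup>1\<close>.\<close>
  define L :: "point \<Rightarrow> point" where "L z = (\<chi> i. z $ 1 * f 1 i + z $ 2 * f 2 i)" for z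
  have L: "(L has_derivative L) (at z)" for z
  proof (rule bounded_linear_imp_has_derivative)
    show "bounded_linear L"
      unfolding linear_conv_bounded_linear[symmetric]
      by (intro linearI) (simp_all add: L_def vec_eq_iff algebra_simps)
  qed
  define M :: "point \<Rightarrow> point" where "M y = (\<chi> i. y $ 1 * e 1 i + y $ 2 * e 2 i)" for y
  have LM: "L (M y) = y" for y
  proof -
    have "L (M y) $ i = y $ i" for i
    proof -
      have "L (M y) $ i = y $ 1 * (e 1 1 * f 1 i + e 1 2 * f 2 i) + y $ 2 * (e 2 1 * f 1 i + e 2 2 * f 2 i)"
        by (simp add: L_def M_def algebra_simps)
      then show ?thesis unfolding ef using exhaust_2[of i] by auto
    qed
    then show ?thesis by (simp add: vec_eq_iff)
  qed
  define V' where "V' = L -` V"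
  define E where "E a k z = (f a 1 * X 1 k (L z) + f a 2 * X 2 k (L z)) / \<Psi> 1 (L z)" for a k z
  \<comment> \<open>Tensor transformation of \<open>A\<close> under a linear change of coordinates:
    \<open>B\<close> treats the two lower indices by \<open>f\<close>, and \<open>A'\<close> then
    treats the upper one by \<open>e\<close>.\<close>
  define B where "B b a l = f a 1 * (f b 1 * A 1 1 l + f b 2 * A 2 1 l)
      + f a 2 * (f b 1 * A 1 2 l + f b 2 * A 2 2 l)" for b a l
  define A' where "A' b a c = B b a 1 * e 1 c + B b a 2 * e 2 c" for b a c
  have "continuous_on UNIV L"
    using L by (meson has_derivative_continuous_on has_derivative_at_withinI)
  then have 1: "open V'" unfolding V'_def using V(1) open_vimage by blast
  have 2: "M y0 \<in> V'" by (simp add: V'_def LM V)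
  have 3: "A' i j k = A' j i k" for i j k
    using A[of 2 1] by (simp add: A'_def B_def algebra_simps)
  have 4: "E a k (M y0) = (if a = k then 1 else 0)" for a k
    using fe[of a k] by (simp add: E_def LM e_def add_divide_distrib)
  have 5: "has_partials (E a k)
      ((\<Sum>l\<in>UNIV. A' 1 a l * E l k z) - (\<Sum>l\<in>UNIV. \<Sum>m\<in>UNIV. E 1 l z * E a m z * C l m k)
        - E 1 1 z * E a k z)
      ((\<Sum>l\<in>UNIV. A' 2 a l * E l k z) - (\<Sum>l\<in>UNIV. \<Sum>m\<in>UNIV. E 2 l z * E a m z * C l m k)
        - E 2 1 z * E a k z) z" if z: "z \<in> V'" for z a k
  proof -
    have Lz: "L z \<in> V" using z by (simp add: V'_def)
    have pz: "\<Psi> 1 (L z) \<noteq> 0" using pos[OF Lz] by simp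
    have comp: "has_partials (\<lambda>z. F (L z)) (f 1 1 * a + f 1 2 * b) (f 2 1 * a + f 2 2 * b) z"
      if "has_partials F a b (L z)" for F a b
      using has_derivative_compose[OF L that[unfolded has_partials_def]]
      by (simp add: has_partials_def L_def algebra_simps)
    define x where "x = \<Psi> 1 (L z)"
    define Y where "Y a k = X a k (L z) / x" for a k
    have x: "x \<noteq> 0" using pz by (simp add: x_def)
    have XY: "X a k (L z) = x * Y a k" for a k using x by (simp add: Y_def)
    have EY: "E a k z = f a 1 * Y 1 k + f a 2 * Y 2 k" for a k
      using x by (simp add: E_def Y_def x_def add_divide_distrib)
    have eE: "e l 1 * E 1 k z + e l 2 * E 2 k z = Y l k" for l k
    proof -
      have "e l 1 * E 1 k z + e l 2 * E 2 k z = (e l 1 * f 1 1 + e l 2 * f 2 1) * Y 1 k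
          + (e l 1 * f 1 2 + e l 2 * f 2 2) * Y 2 k"
        by (simp add: EY algebra_simps)
      then show ?thesis unfolding ef using exhaust_2[of l] by auto
    qed
    have A'E: "(\<Sum>l\<in>UNIV. A' b a l * E l k z) = B b a 1 * Y 1 k + B b a 2 * Y 2 k" for b
      unfolding eE[symmetric] by (simp add: A'_def sum_2 algebra_simps)
    have E_fun: "E a k = (\<lambda>z. (f a 1 * X 1 k (L z) + f a 2 * X 2 k (L z)) / \<Psi> 1 (L z))"
      by (simp add: E_def fun_eq_iff)
    show ?thesis
      unfolding A'E unfolding EY unfolding E_fun
      by (rule has_partials_eqI, (rule comp[OF dX[OF Lz]] comp[OF d\<Psi>[OF Lz]] has_partials_raw_intros pz)+)
         (use x in \<open>simp_all add: XY x_def[symmetric] sum_2 B_def C[of 2 1] power2_eq_square field_simps\<close>)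
  qed
  show thesis by (rule that[OF 1 2 3 4 5])
qed

section \<open>Comparison of the Ricci tensors of \<open>C\<close> and of constant chart
  coefficients\<close>

text \<open>Lower case letters are coefficients of \<open>C\<close>, capitals those of the chart;
  both have the Ricci components \<open>r11\<close>, \<open>r12\<close>, \<open>r22\<close>.
  Degeneracy and the relations \<open>N\<close> give \<open>r22 = 0\<close>, hence
  \<open>r12 = 0\<close> and \<open>s = S\<close>, \<open>u = U\<close>. The Ricci formulas of the
  chart then force \<open>S\<close> and \<open>U\<close> to vanish.\<close>

lemma type_A_type_B_rank_one:
  fixes s t u v P Q S T U W r11 r12 r22 :: real
  assumes rC: "v = - s"
    and rA: "r11 = P * T + Q * W - Q * S - T^2" "r12 = S * T - Q * U" "r22 = P * U - T * U + S * W - S^2"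
    and N: "(s - S) * r11 + (t - T) * r12 = 0" "(u - U) * r11 + (v - W) * r12 = r22" "(u - U) * r12 + (v - W) * r22 = 0"
    and nz: "\<not> (r11 = 0 \<and> r12 = 0 \<and> r22 = 0)" and deg: "r11 * r22 = r12^2"
  shows "s = 0 \<and> u = 0 \<and> v = 0"
proof -
  have "r22 * r22 = (u - U) * (r11 * r22 - r12^2) + r12 * ((u - U) * r12 + (v - W) * r22)"
    by (subst (1) N(2)[symmetric]) (simp add: algebra_simps power2_eq_square)
  then have r22: "r22 = 0" using deg N(3) by simp
  then have r12: "r12 = 0" using deg by simp
  with nz r22 have r11: "r11 \<noteq> 0" by simp
  have sS: "s = S" "u = U" using N(1,2) r11 r12 r22 by auto
  have e1: "S * T = Q * U" and e2: "(P - T) * U + S * (W - S) = 0" and e3: "T * (P - T) + Q * (W - S) \<noteq> 0"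
    using rA r11 r12 r22 by (auto simp: algebra_simps power2_eq_square)
  \<comment> \<open>The left side is \<open>U * r11\<close>; the right side is a combination of
    \<open>r22\<close> and \<open>r12\<close>, both zero.\<close>
  have "U * (T * (P - T) + Q * (W - S)) = T * ((P - T) * U + S * (W - S)) + (W - S) * (Q * U - S * T)"
    by (simp add: algebra_simps)
  then have U: "U = 0" using e1 e2 e3 by simp
  have "S * (T * (P - T) + Q * (W - S)) = 0" using e1 e2 U by algebra
  then have "S = 0" using e3 by simp
  with sS U rC show ?thesis by simp
qed

text \<open>Below \<open>(k, l; l, m)\<close> is the inverse of the Ricci matrix. The differences of the coefficients of
  \<open>C\<close> and \<open>A\<close> are those of the Levi-Civita connection of \<open>(x\<^sup>1)\<^sup>-\<^sup>2\<close> times the Ricci matrix. The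
  trace identity that yields \<open>r22 = 0\<close> says that the scalar curvature of this metric vanishes.\<close>

lemma type_A_type_B_rank_two:
  fixes p q s t u v P Q S T U W r11 r12 r22 :: real
  assumes rC: "r11 = t + p * t + q * v - q * s - t^2" "r12 = v + s * t - q * u" "r12 = - s + s * t - q * u"
      "r22 = - u + p * u - t * u + s * v - s^2"
    and rA: "r11 = P * T + Q * W - Q * S - T^2" "r12 = S * T - Q * U" "r22 = P * U - T * U + S * W - S^2"
    and N: "(p - P) * r11 + (q - Q) * r12 = - r11" "(p - P) * r12 + (q - Q) * r22 = - 2 * r12"
      "(s - S) * r11 + (t - T) * r12 = 0" "(s - S) * r12 + (t - T) * r22 = - r22"
      "(u - U) * r11 + (v - W) * r12 = r22" "(u - U) * r12 + (v - W) * r22 = 0"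
    and nd: "r11 * r22 - r12^2 \<noteq> 0"
  shows False
proof -
  define d where "d = r11 * r22 - r12^2"
  define k where "k = r22 / d"
  define l where "l = - r12 / d"
  define m where "m = r11 / d"
  have d: "d \<noteq> 0" using nd by (simp add: d_def)
  have kl: "k * r11 + l * r12 = 1" "k * r12 + l * r22 = 0" "l * r11 + m * r12 = 0" "l * r12 + m * r22 = 1"
    using d by (simp_all add: k_def l_def m_def field_simps)
      (simp_all add: d_def algebra_simps power2_eq_square)
  \<comment> \<open>Each pair of relations in \<open>N\<close> is a linear system for two
    coefficient differences, solved by the inverse Ricci matrix.\<close>
  have eqs: "p = P - 2 + r11 * k" "q = Q + r11 * l" "s = S + r12 * k" "t = T - 1 + r12 * l"
      "u = U + r22 * k" "v = W + r22 * l"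
    using N kl by algebra+
  \<comment> \<open>The Codazzi symmetry of the covariant derivative of the Ricci tensor, which
    holds identically for the connection with constant coefficients.\<close>
  have A: "P * r12 + Q * r22 = S * r11 + T * r12" "U * r11 + W * r12 = S * r12 + T * r22"
    unfolding rA by algebra+
  have "W + S = 0" using rC(2,3) eqs kl by algebra
  with A kl have "r22 * ((t + p * t + q * v - q * s - t^2) - (P * T + Q * W - Q * S - T^2))
      - 2 * r12 * ((v + s * t - q * u) - (S * T - Q * U))
      + r11 * ((- u + p * u - t * u + s * v - s^2) - (P * U - T * U + S * W - S^2)) = - 2 * r22"
    unfolding eqs by algebra
  then have r22: "r22 = 0" unfolding rC(1,2,4)[symmetric] rA[symmetric] by simp
  with nd have r12: "r12 \<noteq> 0" by auto
  have "u = U" "s = S" using r22 kl r12 N(6,4) by auto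
  moreover have "v = W" "t = T" using calculation N(3,5) r22 r12 by auto
  moreover have "p = P - 2"
  proof -
    have "(p - P + 2) * r12 = 0" using N(2) r22 by algebra
    then show ?thesis using r12 by simp
  qed
  moreover have "v = - s" using rC(2,3) by simp
  \<comment> \<open>The two formulas for \<open>r22\<close> now differ by \<open>3 * u\<close>;
    after \<open>u = 0\<close> they reduce to \<open>s\<^sup>2 = 0\<close>.\<close>
  ultimately have "u = 0" "s = 0" using rC(4) rA(3) r22 by (auto simp: algebra_simps power2_eq_square)
  with rC(3) r12 show False by simp
qed

text \<open>The last premise allows an integrability condition to be stated in a chosen form
  \<open>X = Y\<close>, detached from the computed derivatives.\<close>

lemma has_partials_commute_eqI:
  assumes "open S" "p \<in> S" "\<And>q. q \<in> S \<Longrightarrow> has_partials F (F1 q) (F2 q) q"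
    and "has_partials F1 a b p" "has_partials F2 c d p" "c - b = X - Y"
  shows "X = Y"
  using has_partials_commute[OF assms(1-5)] assms(6) by simp

lemma has_partials_eq_onI:
  assumes "open S" "p \<in> S" "\<And>q. q \<in> S \<Longrightarrow> f q = g q"
    and "has_partials f a b p" "has_partials g c d p"
  shows "a - c = X - Y \<Longrightarrow> X = Y" "b - d = X - Y \<Longrightarrow> X = Y"
  using has_partials_unique[OF has_partials_cong[OF assms(4,1,2,3)] assms(5)] by auto

text \<open>The first four relations compare the Ricci tensors and come from equality of mixed derivatives. The
  last six compare the covariant derivatives of the Ricci tensors and come from differentiating the
  curvature identities once.\<close>

lemma frame_system_relations:
  fixes e11 e12 e21 e22 :: "point \<Rightarrow> real" and p q s t u v P Q S T U W :: real
  assumes V: "open V" "z0 \<in> V"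
    and id: "e11 z0 = 1" "e12 z0 = 0" "e21 z0 = 0" "e22 z0 = 1"
    and d11: "\<And>z. z \<in> V \<Longrightarrow> has_partials e11
      (P * e11 z + Q * e21 z - (p * e11 z * e11 z + 2 * s * e11 z * e12 z + u * e12 z * e12 z)
        - e11 z * e11 z)
      (S * e11 z + T * e21 z - (p * e21 z * e11 z + s * (e21 z * e12 z + e22 z * e11 z)
        + u * e22 z * e12 z)
        - e21 z * e11 z) z"
    and d12: "\<And>z. z \<in> V \<Longrightarrow> has_partials e12
      (P * e12 z + Q * e22 z - (q * e11 z * e11 z + 2 * t * e11 z * e12 z + v * e12 z * e12 z)
        - e11 z * e12 z)
      (S * e12 z + T * e22 z - (q * e21 z * e11 z + t * (e21 z * e12 z + e22 z * e11 z)
        + v * e22 z * e12 z)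
        - e21 z * e12 z) z"
    and d21: "\<And>z. z \<in> V \<Longrightarrow> has_partials e21
      (S * e11 z + T * e21 z - (p * e21 z * e11 z + s * (e21 z * e12 z + e22 z * e11 z)
        + u * e22 z * e12 z)
        - e11 z * e21 z)
      (U * e11 z + W * e21 z - (p * e21 z * e21 z + 2 * s * e21 z * e22 z + u * e22 z * e22 z)
        - e21 z * e21 z) z"
    and d22: "\<And>z. z \<in> V \<Longrightarrow> has_partials e22
      (S * e12 z + T * e22 z - (q * e21 z * e11 z + t * (e21 z * e12 z + e22 z * e11 z)
        + v * e22 z * e12 z)
        - e11 z * e22 z)
      (U * e12 z + W * e22 z - (q * e21 z * e21 z + 2 * t * e21 z * e22 z + v * e22 z * e22 z)
        - e21 z * e22 z) z"
  defines "r11 \<equiv> t + p * t + q * v - q * s - t\<^sup>2" and "r12 \<equiv> v + s * t - q * u"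
    and "r21 \<equiv> - s + s * t - q * u" and "r22 \<equiv> - u + p * u - t * u + s * v - s\<^sup>2"
  shows "r12 = r21"
    and "r11 = P * T + Q * W - Q * S - T\<^sup>2" "r12 = S * T - Q * U" "r22 = P * U - T * U + S * W - S\<^sup>2"
    and "(p - P) * r11 + (q - Q) * r12 = - r11" "(p - P) * r12 + (q - Q) * r22 = - 2 * r12"
      "(s - S) * r11 + (t - T) * r12 = 0" "(s - S) * r12 + (t - T) * r22 = - r22"
      "(u - U) * r11 + (v - W) * r12 = r22" "(u - U) * r12 + (v - W) * r22 = 0"
proof -
  \<comment> \<open>Each of the four identities equates the curvature of the constant chart
    coefficients with that of \<open>C\<close> evaluated on the frame. At \<open>z0\<close>, where
    the frame is the identity, they compare Ricci components.\<close>
  have c11: "(S * T - Q * U) * e11 z - (P * T + Q * W - Q * S - T\<^sup>2) * e21 z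
      = (e11 z * e22 z - e12 z * e21 z) * (r21 * e11 z + r22 * e12 z)" if z: "z \<in> V" for z
    by (rule has_partials_commute_eqI[OF V(1) z d11],
        (rule d11[OF z] d12[OF z] d21[OF z] d22[OF z] has_partials_raw_intros | assumption)+)
       (simp add: r21_def r22_def algebra_simps power2_eq_square)
  have c12: "(S * T - Q * U) * e12 z - (P * T + Q * W - Q * S - T\<^sup>2) * e22 z
      = (e11 z * e22 z - e12 z * e21 z) * (- r11 * e11 z - r12 * e12 z)" if z: "z \<in> V" for z
    by (rule has_partials_commute_eqI[OF V(1) z d12],
        (rule d11[OF z] d12[OF z] d21[OF z] d22[OF z] has_partials_raw_intros | assumption)+)
       (simp add: r11_def r12_def algebra_simps power2_eq_square)
  have c21: "(P * U - T * U + S * W - S\<^sup>2) * e11 z - (S * T - Q * U) * e21 z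
      = (e11 z * e22 z - e12 z * e21 z) * (r21 * e21 z + r22 * e22 z)" if z: "z \<in> V" for z
    by (rule has_partials_commute_eqI[OF V(1) z d21],
        (rule d11[OF z] d12[OF z] d21[OF z] d22[OF z] has_partials_raw_intros | assumption)+)
       (simp add: r21_def r22_def algebra_simps power2_eq_square)
  have c22: "(P * U - T * U + S * W - S\<^sup>2) * e12 z - (S * T - Q * U) * e22 z
      = (e11 z * e22 z - e12 z * e21 z) * (- r11 * e21 z - r12 * e22 z)" if z: "z \<in> V" for z
    by (rule has_partials_commute_eqI[OF V(1) z d22],
        (rule d11[OF z] d12[OF z] d21[OF z] d22[OF z] has_partials_raw_intros | assumption)+)
       (simp add: r11_def r12_def algebra_simps power2_eq_square)
  show r: "r12 = r21" "r11 = P * T + Q * W - Q * S - T\<^sup>2" "r12 = S * T - Q * U" "r22 = P * U - T * U + S * W - S\<^sup>2"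
    using c11[OF V(2)] c12[OF V(2)] c21[OF V(2)] c22[OF V(2)] unfolding id by simp_all
  note c = c11 c12 c21 c22
  note c' = c[folded r(2,3,4) r(1)]
  note D = d11[OF V(2)] d12[OF V(2)] d21[OF V(2)] d22[OF V(2)]
  \<comment> \<open>The identities \<open>c'\<close> hold on all of \<open>V\<close>, so they can be
    differentiated at \<open>z0\<close>: along the first coordinate for \<open>n1\<close> to
    \<open>n4\<close>, along the second for \<open>n5\<close> to \<open>n8\<close>.\<close>
  have n1: "r12 * (P - p - 1) - r11 * (S - s)
      = ((P - p - 1) + (T - t - 1)) * r12 + (P - p - 1) * r12 + (Q - q) * r22"
    by (rule has_partials_eq_onI(1)[OF V c'(1)], (rule D has_partials_raw_intros | assumption)+)
       (simp add: id algebra_simps)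
  have n2: "r12 * (Q - q) - r11 * (T - t - 1)
      = ((P - p - 1) + (T - t - 1)) * (- r11) + (P - p - 1) * (- r11) + (Q - q) * (- r12)"
    by (rule has_partials_eq_onI(1)[OF V c'(2)], (rule D has_partials_raw_intros | assumption)+)
       (simp add: id algebra_simps)
  have n3: "r22 * (P - p - 1) - r12 * (S - s)
      = ((P - p - 1) + (T - t - 1)) * r22 + (S - s) * r12 + (T - t - 1) * r22"
    by (rule has_partials_eq_onI(1)[OF V c'(3)], (rule D has_partials_raw_intros | assumption)+)
       (simp add: id algebra_simps)
  have n4: "r22 * (Q - q) - r12 * (T - t - 1)
      = ((P - p - 1) + (T - t - 1)) * (- r12) + (S - s) * (- r11) + (T - t - 1) * (- r12)"
    by (rule has_partials_eq_onI(1)[OF V c'(4)], (rule D has_partials_raw_intros | assumption)+)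
       (simp add: id algebra_simps)
  have n5: "r12 * (S - s) - r11 * (U - u)
      = ((S - s) + (W - v)) * r12 + (S - s) * r12 + (T - t) * r22"
    by (rule has_partials_eq_onI(2)[OF V c'(1)], (rule D has_partials_raw_intros | assumption)+)
       (simp add: id algebra_simps)
  have n6: "r12 * (T - t) - r11 * (W - v)
      = ((S - s) + (W - v)) * (- r11) + (S - s) * (- r11) + (T - t) * (- r12)"
    by (rule has_partials_eq_onI(2)[OF V c'(2)], (rule D has_partials_raw_intros | assumption)+)
       (simp add: id algebra_simps)
  have n7: "r22 * (S - s) - r12 * (U - u)
      = ((S - s) + (W - v)) * r22 + (U - u) * r12 + (W - v) * r22"
    by (rule has_partials_eq_onI(2)[OF V c'(3)], (rule D has_partials_raw_intros | assumption)+)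
       (simp add: id algebra_simps)
  have n8: "r22 * (T - t) - r12 * (W - v)
      = ((S - s) + (W - v)) * (- r12) + (U - u) * (- r11) + (W - v) * (- r12)"
    by (rule has_partials_eq_onI(2)[OF V c'(4)], (rule D has_partials_raw_intros | assumption)+)
       (simp add: id algebra_simps)
  show "(p - P) * r11 + (q - Q) * r12 = - r11"
    using n1 n2 n3 n4 n5 n6 n7 n8 by algebra
  show "(p - P) * r12 + (q - Q) * r22 = - 2 * r12"
    using n1 n2 n3 n4 n5 n6 n7 n8 by algebra
  show "(s - S) * r11 + (t - T) * r12 = 0"
    using n1 n2 n3 n4 n5 n6 n7 n8 by algebra
  show "(s - S) * r12 + (t - T) * r22 = - r22"
    using n1 n2 n3 n4 n5 n6 n7 n8 by algebra
  show "(u - U) * r11 + (v - W) * r12 = r22"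
    using n1 n2 n3 n4 n5 n6 n7 n8 by algebra
  show "(u - U) * r12 + (v - W) * r22 = 0"
    using n1 n2 n3 n4 n5 n6 n7 n8 by algebra
qed

text \<open>A chart around (1, 1) supplies the normalised frame and with it all relations between
  the coefficients. The Ricci matrix is nonzero because the connection is not flat, rank two is
  contradictory, and rank one gives the claim.\<close>

lemma type_A_imp_coeffs:
  assumes C: "\<And>i j k. C i j k = C j i k"
    and nf: "\<not> flat_on half_plane (type_B_connection C)"
    and A: "type_A half_plane (type_B_connection C)"
  shows "C 1 2 1 = 0 \<and> C 2 2 1 = 0 \<and> C 2 2 2 = 0"
proof -
  have "(\<chi> i. 1) \<in> half_plane" by (simp add: half_plane_def)
  then obtain U \<phi> \<psi> A0 where ch: "chart U \<phi> \<psi>" "(\<chi> i. 1) \<in> U" "U \<subseteq> half_plane"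
    "christoffel_in_chart (type_B_connection C) U \<phi> \<psi> (\<lambda>_. A0)"
    using A unfolding type_A_def by blast
  show ?thesis
  proof (rule chart_frame_system[OF ch])
    fix V0 y0 and \<Psi> :: "2 \<Rightarrow> point \<Rightarrow> real" and X :: "2 \<Rightarrow> 2 \<Rightarrow> point \<Rightarrow> real"
    assume 1: "open V0" "y0 \<in> V0" "\<And>y. y \<in> V0 \<Longrightarrow> \<Psi> 1 y > 0"
      "\<And>y k. y \<in> V0 \<Longrightarrow> has_partials (\<Psi> k) (X 1 k y) (X 2 k y) y"
      "\<And>y j k. y \<in> V0 \<Longrightarrow> has_partials (X j k)
         ((\<Sum>l\<in>UNIV. A0 1 j l * X l k y)
            - (\<Sum>l\<in>UNIV. \<Sum>m\<in>UNIV. X 1 l y * X j m y * C l m k) / \<Psi> 1 y)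
         ((\<Sum>l\<in>UNIV. A0 2 j l * X l k y)
            - (\<Sum>l\<in>UNIV. \<Sum>m\<in>UNIV. X 2 l y * X j m y * C l m k) / \<Psi> 1 y) y"
      "\<And>y. y \<in> V0 \<Longrightarrow> X 1 1 y * X 2 2 y - X 1 2 y * X 2 1 y \<noteq> 0"
    show ?thesis
    proof (rule normalised_frame_system[of C V0 y0 \<Psi> X A0, OF C 1])
      fix V z0 and E :: "2 \<Rightarrow> 2 \<Rightarrow> point \<Rightarrow> real" and A' :: coeffs
      assume V: "open V" "z0 \<in> V" and A': "\<And>i j k. A' i j k = A' j i k"
        and id: "\<And>a k. E a k z0 = (if a = k then 1 else 0)"
        and dE: "\<And>z a k. z \<in> V \<Longrightarrow> has_partials (E a k)
          ((\<Sum>l\<in>UNIV. A' 1 a l * E l k z) - (\<Sum>l\<in>UNIV. \<Sum>m\<in>UNIV. E 1 l z * E a m z * C l m k)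
            - E 1 1 z * E a k z)
          ((\<Sum>l\<in>UNIV. A' 2 a l * E l k z) - (\<Sum>l\<in>UNIV. \<Sum>m\<in>UNIV. E 2 l z * E a m z * C l m k)
            - E 2 1 z * E a k z) z"
      define p q s t u v where c: "p = C 1 1 1" "q = C 1 1 2" "s = C 1 2 1" "t = C 1 2 2"
        "u = C 2 2 1" "v = C 2 2 2"
      define P Q S T U' W where a: "P = A' 1 1 1" "Q = A' 1 1 2" "S = A' 1 2 1" "T = A' 1 2 2"
        "U' = A' 2 2 1" "W = A' 2 2 2"
      note ca = c[symmetric] a[symmetric] C[of 2 1] A'[of 2 1]
      have F: "E 1 1 z0 = 1" "E 1 2 z0 = 0" "E 2 1 z0 = 0" "E 2 2 z0 = 1" by (simp_all add: id)
      have d: "\<And>z. z \<in> V \<Longrightarrow> has_partials (E 1 1)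
          (P * E 1 1 z + Q * E 2 1 z - (p * E 1 1 z * E 1 1 z + 2 * s * E 1 1 z * E 1 2 z + u * E 1 2 z * E 1 2 z)
            - E 1 1 z * E 1 1 z)
          (S * E 1 1 z + T * E 2 1 z - (p * E 2 1 z * E 1 1 z + s * (E 2 1 z * E 1 2 z + E 2 2 z * E 1 1 z)
            + u * E 2 2 z * E 1 2 z)
            - E 2 1 z * E 1 1 z) z"
        "\<And>z. z \<in> V \<Longrightarrow> has_partials (E 1 2)
          (P * E 1 2 z + Q * E 2 2 z - (q * E 1 1 z * E 1 1 z + 2 * t * E 1 1 z * E 1 2 z + v * E 1 2 z * E 1 2 z)
            - E 1 1 z * E 1 2 z)
          (S * E 1 2 z + T * E 2 2 z - (q * E 2 1 z * E 1 1 z + t * (E 2 1 z * E 1 2 z + E 2 2 z * E 1 1 z)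
            + v * E 2 2 z * E 1 2 z)
            - E 2 1 z * E 1 2 z) z"
        "\<And>z. z \<in> V \<Longrightarrow> has_partials (E 2 1)
          (S * E 1 1 z + T * E 2 1 z - (p * E 2 1 z * E 1 1 z + s * (E 2 1 z * E 1 2 z + E 2 2 z * E 1 1 z)
            + u * E 2 2 z * E 1 2 z)
            - E 1 1 z * E 2 1 z)
          (U' * E 1 1 z + W * E 2 1 z - (p * E 2 1 z * E 2 1 z + 2 * s * E 2 1 z * E 2 2 z + u * E 2 2 z * E 2 2 z)
            - E 2 1 z * E 2 1 z) z"
        "\<And>z. z \<in> V \<Longrightarrow> has_partials (E 2 2)
          (S * E 1 2 z + T * E 2 2 z - (q * E 2 1 z * E 1 1 z + t * (E 2 1 z * E 1 2 z + E 2 2 z * E 1 1 z)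
            + v * E 2 2 z * E 1 2 z)
            - E 1 1 z * E 2 2 z)
          (U' * E 1 2 z + W * E 2 2 z - (q * E 2 1 z * E 2 1 z + 2 * t * E 2 1 z * E 2 2 z + v * E 2 2 z * E 2 2 z)
            - E 2 1 z * E 2 2 z) z"
        by (rule has_partials_eqI[OF dE], assumption; simp add: sum_2 ca algebra_simps)+
      note rel = frame_system_relations[OF V F d]
      define r11 r12 r22 where r: "r11 = t + p * t + q * v - q * s - t\<^sup>2" "r12 = v + s * t - q * u"
        "r22 = - u + p * u - t * u + s * v - s\<^sup>2"
      have "\<not> (r11 = 0 \<and> r12 = 0 \<and> r22 = 0)"
      proof
        assume 0: "r11 = 0 \<and> r12 = 0 \<and> r22 = 0"
        have "ricci_coeff C j k = 0" for j k
          using exhaust_2[of j] exhaust_2[of k] 0 rel(1) ricci_coeff_eqs[of C, OF C]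
          by (auto simp: r ca)
        then show False using nf flat_on_if_ricci_coeff_0[of C, OF C] by blast
      qed
      moreover have "v = - s" using rel(1) by simp
      moreover have "r11 * r22 - r12\<^sup>2 = 0"
        using type_A_type_B_rank_two[of r11 t p q v s r12 u r22 P T Q W S U', OF r(1,2) _ r(3)]
          rel r by metis
      ultimately have "s = 0 \<and> u = 0 \<and> v = 0"
        using type_A_type_B_rank_one[of v s r11 P T Q W S r12 U' r22 t u] rel[folded r] by simp
      then show ?thesis by (simp add: c)
    qed
  qed
qed

section \<open>Smoothness of explicit functions\<close>

text \<open>A class closed under partial differentiation that contains the components of the charts
  and the solitons used below. The set \<open>S\<close> is \<open>half_plane\<close> for charts and
  solitons, and \<open>UNIV\<close> for inverse charts with exponentials.\<close>

inductive elementary :: "point set \<Rightarrow> (point \<Rightarrow> real) \<Rightarrow> bool" for S where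
  const: "elementary S (\<lambda>p. c)"
| nth: "elementary S (\<lambda>p. p $ k)"
| exp: "elementary S (\<lambda>p. exp (p $ 1))"
| inverse: "S \<subseteq> half_plane \<Longrightarrow> elementary S (\<lambda>p. 1 / p $ 1)"
| ln: "S \<subseteq> half_plane \<Longrightarrow> elementary S (\<lambda>p. ln (p $ 1))"
| add: "elementary S f \<Longrightarrow> elementary S g \<Longrightarrow> elementary S (\<lambda>p. f p + g p)"
| mult: "elementary S f \<Longrightarrow> elementary S g \<Longrightarrow> elementary S (\<lambda>p. f p * g p)"

lemma has_partials_exp:
  "has_partials f a b p \<Longrightarrow> has_partials (\<lambda>p. exp (f p)) (exp (f p) * a) (exp (f p) * b) p"
  by (rule has_partials_compose) (auto intro: DERIV_exp)

lemma has_partials_ln: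
  "has_partials f a b p \<Longrightarrow> f p > 0 \<Longrightarrow> has_partials (\<lambda>p. ln (f p)) (1 / f p * a) (1 / f p * b) p"
  by (rule has_partials_compose) (auto intro: DERIV_ln_divide)

lemma elementary_has_partials:
  assumes "elementary S f"
  shows "\<exists>f1 f2. elementary S f1 \<and> elementary S f2 \<and> (\<forall>p\<in>S. has_partials f (f1 p) (f2 p) p)"
  using assms
proof induction
  case (const c)
  then show ?case by (blast intro: elementary.const has_partials_const)
next
  case (nth k)
  consider "k = 1" | "k = 2" using exhaust_2 by blast
  then show ?case
  proof cases
    case 1
    show ?thesis unfolding 1
      by (rule exI[of _ "\<lambda>_. 1"], rule exI[of _ "\<lambda>_. 0"])
         (auto intro: elementary.const has_partials_nth_1)
  next
    case 2
    show ?thesis unfolding 2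
      by (rule exI[of _ "\<lambda>_. 0"], rule exI[of _ "\<lambda>_. 1"])
         (auto intro: elementary.const has_partials_nth_2)
  qed
next
  case exp
  have "has_partials (\<lambda>p. exp (p $ 1)) (exp (p $ 1)) 0 p" for p
    by (rule has_partials_eqI[OF has_partials_exp[OF has_partials_nth_1[OF refl refl]]]) auto
  then show ?case by (blast intro: elementary.intros)
next
  case inverse
  have "has_partials (\<lambda>p. 1 / p $ 1) (- 1 * (1 / p $ 1 * (1 / p $ 1))) 0 p" if "p \<in> S" for p
    using that inverse
    by - (rule has_partials_divide[OF has_partials_const[OF refl refl] has_partials_nth_1[OF refl refl]],
       auto simp: half_plane_def power2_eq_square)
  with inverse show ?case
    by (intro exI[of _ "\<lambda>p. - 1 * (1 / p $ 1 * (1 / p $ 1))"] exI[of _ "\<lambda>_. 0"] conjI ballI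
        elementary.intros) auto
next
  case ln
  have "has_partials (\<lambda>p. ln (p $ 1)) (1 / p $ 1) 0 p" if "p \<in> S" for p
    using that ln
    by - (rule has_partials_eqI[OF has_partials_ln[OF has_partials_nth_1[OF refl refl]]],
       auto simp: half_plane_def)
  with ln show ?case
    by (intro exI[of _ "\<lambda>p. 1 / p $ 1"] exI[of _ "\<lambda>_. 0"] conjI ballI elementary.intros) auto
next
  case (add f g)
  then obtain f1 f2 g1 g2 where "elementary S f1" "elementary S f2" "elementary S g1" "elementary S g2"
    "\<forall>p\<in>S. has_partials f (f1 p) (f2 p) p" "\<forall>p\<in>S. has_partials g (g1 p) (g2 p) p" by blast
  then show ?case
    by (intro exI[of _ "\<lambda>p. f1 p + g1 p"] exI[of _ "\<lambda>p. f2 p + g2 p"] conjI ballI elementary.intros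
        has_partials_add[OF _ _ refl refl]) auto
next
  case (mult f g)
  then obtain f1 f2 g1 g2 where "elementary S f1" "elementary S f2" "elementary S g1" "elementary S g2"
    "\<forall>p\<in>S. has_partials f (f1 p) (f2 p) p" "\<forall>p\<in>S. has_partials g (g1 p) (g2 p) p" by blast
  with mult.hyps show ?case
    by (intro exI[of _ "\<lambda>p. f1 p * g p + f p * g1 p"] exI[of _ "\<lambda>p. f2 p * g p + f p * g2 p"] conjI
        ballI elementary.intros has_partials_mult[OF _ _ refl refl]) auto
qed

lemma elementary_smooth:
  assumes "open S" "elementary S f"
  shows "smooth_on S f"
proof -
  have "Ck_on n S f" for n
    using assms(2)
  proof (induction n arbitrary: f)
    case 0
    obtain f1 f2 where "\<forall>p\<in>S. has_partials f (f1 p) (f2 p) p"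
      using elementary_has_partials[OF 0] by blast
    then have "f differentiable (at p)" if "p \<in> S" for p
      using that unfolding has_partials_def differentiable_def by blast
    then have "f differentiable_on S" by (simp add: differentiable_at_imp_differentiable_on)
    then show ?case unfolding Ck_on.simps by (rule differentiable_imp_continuous_on)
  next
    case (Suc n)
    obtain f1 f2 where f: "elementary S f1" "elementary S f2"
      "\<And>p. p \<in> S \<Longrightarrow> has_partials f (f1 p) (f2 p) p"
      using elementary_has_partials[OF Suc.prems] by blast
    then have "f differentiable (at p)" if "p \<in> S" for p
      using that unfolding has_partials_def differentiable_def by blast
    then have "f differentiable_on S" by (simp add: differentiable_at_imp_differentiable_on)
    moreover have "Ck_on n S (\<lambda>p. frechet_derivative f (at p) (axis i 1))" for i
    proof (rule Ck_on_cong[OF assms(1)])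
      show "Ck_on n S (if i = 1 then f1 else f2)" using Suc.IH f by auto
      show "(if i = 1 then f1 else f2) p = frechet_derivative f (at p) (axis i 1)" if "p \<in> S" for p
        using exhaust_2[of i] frechet_derivative_at[OF f(3)[OF that, unfolded has_partials_def], symmetric]
        by (auto simp: axis_def)
    qed
    ultimately show ?case unfolding Ck_on.simps by blast
  qed
  then show ?thesis by (simp add: smooth_on_def)
qed

text \<open>Induction on the order as in the scalar case: the partial derivatives of a vector
  function with elementary components again have elementary components.\<close>

lemma elementary_vec_smooth:
  fixes f :: "point \<Rightarrow> real^2"
  assumes "open S" "\<And>k. elementary S (\<lambda>p. f p $ k)"
  shows "smooth_on S f"
proof -
  have ex: "\<exists>f1 f2. (\<forall>k. elementary S (f1 k)) \<and> (\<forall>k. elementary S (f2 k)) \<and>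
      (\<forall>p\<in>S. \<forall>k. has_partials (\<lambda>q. f q $ k) (f1 k p) (f2 k p) p)"
    if "\<And>k. elementary S (\<lambda>p. f p $ k)" for f :: "point \<Rightarrow> real^2"
    using elementary_has_partials[OF that] by metis
  have diff: "f differentiable_on S"
    if f: "\<And>k. elementary S (\<lambda>p. f p $ k)" for f :: "point \<Rightarrow> real^2"
  proof -
    obtain f1 f2 where "\<forall>p\<in>S. \<forall>k. has_partials (\<lambda>q. f q $ k) (f1 k p) (f2 k p) p"
      using ex[OF f] by blast
    then have "f differentiable (at p)" if "p \<in> S" for p
      using has_derivative_vec2I that unfolding differentiable_def by blast
    then show ?thesis by (simp add: differentiable_at_imp_differentiable_on)
  qed
  have "Ck_on n S f" for n
    using assms(2)
  proof (induction n arbitrary: f)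
    case 0
    show ?case unfolding Ck_on.simps using diff[OF 0] by (rule differentiable_imp_continuous_on)
  next
    case (Suc n)
    obtain f1 f2 where f: "\<And>k. elementary S (f1 k)" "\<And>k. elementary S (f2 k)"
      "\<And>p k. p \<in> S \<Longrightarrow> has_partials (\<lambda>q. f q $ k) (f1 k p) (f2 k p) p"
      using ex[OF Suc.prems] by blast
    have "Ck_on n S (\<lambda>p. frechet_derivative f (at p) (axis i 1))" for i
    proof (rule Ck_on_cong[OF assms(1)])
      show "Ck_on n S (\<lambda>p. (\<chi> k. if i = 1 then f1 k p else f2 k p))"
        by (rule Suc.IH) (use f exhaust_2[of i] in auto)
      show "(\<chi> k. if i = 1 then f1 k p else f2 k p) = frechet_derivative f (at p) (axis i 1)"
        if "p \<in> S" for p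
        using exhaust_2[of i] frechet_derivative_nth[of f "\<lambda>k. f1 k p" "\<lambda>k. f2 k p" p, OF f(3)[OF that]]
        by (auto simp: vec_eq_iff axis_def)
    qed
    then show ?case using diff[OF Suc.prems] unfolding Ck_on.simps by blast
  qed
  then show ?thesis by (simp add: smooth_on_def)
qed

subsection \<open>Type B structures of Type A\<close>

text \<open>\<open>F\<close> gives the chart frame by explicit formulas in the original coordinates,
  so that the condition becomes an identity between explicit functions on \<open>U\<close>.\<close>

lemma christoffel_in_chartI:
  assumes U: "open U"
    and F: "\<And>p j k. p \<in> U \<Longrightarrow> chart_frame \<phi> \<psi> j p $ k = F j k p"
    and dF: "\<And>p j k. p \<in> U \<Longrightarrow> has_partials (F j k) (F1 j k p) (F2 j k p) p"
    and eq: "\<And>p i j k. p \<in> U \<Longrightarrow> F i 1 p * F1 j k p + F i 2 p * F2 j k p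
      + (\<Sum>l\<in>UNIV. \<Sum>m\<in>UNIV. F i l p * F j m p * \<Gamma> p l m k)
      = (\<Sum>l\<in>UNIV. \<Gamma>' (\<phi> p) i j l * F l k p)"
  shows "christoffel_in_chart \<Gamma> U \<phi> \<psi> \<Gamma>'"
  unfolding christoffel_in_chart_def
proof (intro ballI allI)
  fix p i j assume p: "p \<in> U"
  have d: "has_partials (\<lambda>q. chart_frame \<phi> \<psi> j q $ k) (F1 j k p) (F2 j k p) p" for k
    by (rule has_partials_cong[OF dF[OF p] U p]) (simp add: F)
  show "cov \<Gamma> (chart_frame \<phi> \<psi> i) (chart_frame \<phi> \<psi> j) p
    = (\<Sum>k\<in>UNIV. \<Gamma>' (\<phi> p) i j k *\<^sub>R chart_frame \<phi> \<psi> k p)"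
    unfolding vec_eq_iff cov_nth[of "chart_frame \<phi> \<psi> j" "\<lambda>k. F1 j k p" "\<lambda>k. F2 j k p" p, OF d]
    using eq[OF p, of i j] p by (simp add: F)
qed

lemma chart_frame_nth:
  assumes "\<And>k. has_partials (\<lambda>y. \<psi> y $ k) (G 1 k) (G 2 k) (\<phi> p)"
  shows "chart_frame \<phi> \<psi> j p $ k = G j k"
  unfolding chart_frame_def
  using frechet_derivative_nth[of \<psi> "G 1" "G 2" "\<phi> p", OF assms] exhaust_2[of j]
  by (auto simp: axis_def)

lemma elementary_diff:
  "elementary S f \<Longrightarrow> elementary S g \<Longrightarrow> elementary S (\<lambda>p. f p - g p)"
  using elementary.add[of S f "\<lambda>p. - 1 * g p"] elementary.mult[of S "\<lambda>_. - 1" g] elementary.const[of S "- 1"]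
  by simp

text \<open>Dilations of both coordinates and translations of the second preserve a Type B
  connection, and together they act transitively on the half plane.\<close>

lemma locally_homogeneous_type_B:
  "locally_homogeneous half_plane (type_B_connection C)"
  unfolding locally_homogeneous_def
proof (intro ballI)
  fix p0 q0 :: point assume h: "p0 \<in> half_plane" "q0 \<in> half_plane"
  define a where "a = q0 $ 1 / p0 $ 1"
  define b where "b = q0 $ 2 - a * p0 $ 2"
  have a: "a > 0" using h by (simp add: a_def half_plane_def)
  define \<phi> :: "point \<Rightarrow> point" where "\<phi> p = vector [a * p $ 1, a * p $ 2 + b]" for p
  define \<psi> :: "point \<Rightarrow> point" where "\<psi> p = vector [(1/a) * p $ 1, (1/a) * p $ 2 - b/a]" for p
  have \<psi>\<phi>: "\<psi> (\<phi> p) = p" "\<phi> (\<psi> p) = p" for p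
    using a by (simp_all add: \<phi>_def \<psi>_def vec_eq_iff forall_2 field_simps)
  have hp: "\<phi> p \<in> half_plane \<longleftrightarrow> p \<in> half_plane" "\<psi> p \<in> half_plane \<longleftrightarrow> p \<in> half_plane" for p
    using a by (simp_all add: \<phi>_def \<psi>_def half_plane_def zero_less_mult_iff zero_less_divide_iff)
  have im: "\<phi> ` half_plane = half_plane"
  proof (intro subset_antisym subsetI)
    fix p assume "p \<in> half_plane"
    then show "p \<in> \<phi> ` half_plane" using \<psi>\<phi> hp by (intro image_eqI[of _ _ "\<psi> p"]) simp_all
  qed (use hp in auto)
  have sm: "elementary half_plane (\<lambda>p. \<phi> p $ k)" "elementary half_plane (\<lambda>p. \<psi> p $ k)" for k
    using exhaust_2[of k] by (auto simp: \<phi>_def \<psi>_def simp del: times_divide_eq_left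
        intro!: elementary_diff elementary.intros)
  have "chart half_plane \<phi> \<psi>"
    unfolding chart_def im using open_half_plane \<psi>\<phi> sm elementary_vec_smooth by blast
  moreover have "\<phi> p0 = q0" using h
    by (simp add: \<phi>_def b_def a_def half_plane_def vec_eq_iff forall_2)
  moreover have "christoffel_in_chart (type_B_connection C) half_plane \<phi> \<psi> (type_B_connection C)"
  proof (rule christoffel_in_chartI[OF open_half_plane])
    show "chart_frame \<phi> \<psi> j p $ k = (if j = k then 1/a else 0)" for p j k
    proof (rule chart_frame_nth)
      show "has_partials (\<lambda>y. \<psi> y $ k) (if 1 = k then 1/a else 0) (if 2 = k then 1/a else 0) (\<phi> p)" for k
        using exhaust_2[of k] unfolding \<psi>_def
        by (elim disjE; simp del: times_divide_eq_left)
          (rule has_partials_eqI, (rule has_partials_exp has_partials_raw_intros | (simp; fail))+)+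
    qed
    show "has_partials (\<lambda>p. if j = k then 1/a else 0) 0 0 p" for p j and k :: 2
      by (rule has_partials_const) auto
    show "(if i = 1 then 1/a else 0) * 0 + (if i = 2 then 1/a else 0) * 0
      + (\<Sum>l\<in>UNIV. \<Sum>m\<in>UNIV. (if i = l then 1/a else 0) * (if j = m then 1/a else 0) * type_B_connection C p l m k)
      = (\<Sum>l\<in>UNIV. type_B_connection C (\<phi> p) i j l * (if l = k then 1/a else 0))"
      if "p \<in> half_plane" for p i j k
      using exhaust_2[of i] exhaust_2[of j] exhaust_2[of k] a that
      by (auto simp: sum_2 type_B_connection_def \<phi>_def half_plane_def field_simps)
  qed
  ultimately show "\<exists>U \<phi> \<psi>. chart U \<phi> \<psi> \<and> p0 \<in> U \<and> U \<subseteq> half_plane \<and> \<phi> ` U \<subseteq> half_plane \<and> \<phi> p0 = q0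
     \<and> christoffel_in_chart (type_B_connection C) U \<phi> \<psi> (type_B_connection C)"
    using im h by blast
qed

text \<open>For \<open>C 1 1 1 \<noteq> 2 * C 1 2 2\<close> a shear removes \<open>C 1 1 2\<close>, and \<open>ln x\<close>, \<open>y\<close> are
  coordinates with constant Christoffel symbols; in the resonant case \<open>ln x\<close>, \<open>y / x\<close> are.\<close>

lemma constant_christoffel_chart:
  assumes C: "\<And>i j k. C i j k = C j i k" and 0: "C 1 2 1 = 0" "C 2 2 1 = 0" "C 2 2 2 = 0"
  shows "\<exists>\<phi> \<psi> A. chart half_plane \<phi> \<psi>
    \<and> christoffel_in_chart (type_B_connection C) half_plane \<phi> \<psi> (\<lambda>_. A)"
proof (cases "C 1 1 1 = 2 * C 1 2 2")
  case False
  define k0 where "k0 = C 1 1 2 / (C 1 1 1 - 2 * C 1 2 2)"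
  have k0: "C 1 1 2 = k0 * (C 1 1 1 - 2 * C 1 2 2)" using False by (simp add: k0_def)
  define \<phi> :: "point \<Rightarrow> point" where "\<phi> p = vector [ln (p $ 1), p $ 2 - k0 * p $ 1]" for p
  define \<psi> :: "point \<Rightarrow> point" where "\<psi> y = vector [exp (y $ 1), y $ 2 + k0 * exp (y $ 1)]" for y
  have \<psi>\<phi>: "\<psi> (\<phi> p) = p" if "p \<in> half_plane" for p
    using that by (simp add: \<phi>_def \<psi>_def vec_eq_iff forall_2 half_plane_def)
  have \<phi>\<psi>: "\<phi> (\<psi> y) = y" "\<psi> y \<in> half_plane" for y
    by (simp_all add: \<phi>_def \<psi>_def vec_eq_iff forall_2 half_plane_def)
  have im: "\<phi> ` half_plane = UNIV" using \<phi>\<psi> by (metis UNIV_eq_I image_eqI)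
  have "elementary half_plane (\<lambda>p. \<phi> p $ k)" "elementary UNIV (\<lambda>p. \<psi> p $ k)" for k
    using exhaust_2[of k] by (auto simp: \<phi>_def \<psi>_def intro!: elementary_diff elementary.intros)
  then have "chart half_plane \<phi> \<psi>"
    unfolding chart_def im using open_half_plane \<psi>\<phi> elementary_vec_smooth by auto
  moreover
  \<comment> \<open>The chart frame in the original coordinates:
    \<open>x\<^sup>1 (\<partial>\<^sub>1 + k0 \<partial>\<^sub>2)\<close> and
    \<open>\<partial>\<^sub>2\<close>.\<close>
  define F :: "2 \<Rightarrow> 2 \<Rightarrow> point \<Rightarrow> real" where "F j k p = (if j = 1 then if k = 1 then p $ 1 else k0 * p $ 1
    else if k = 1 then 0 else 1)" for j k p
  define F1 :: "2 \<Rightarrow> 2 \<Rightarrow> real" where "F1 j k = (if j = 1 then if k = 1 then 1 else k0 else 0)" for j k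
  have "christoffel_in_chart (type_B_connection C) half_plane \<phi> \<psi>
    (\<lambda>_. sym_coeffs (1 + C 1 1 1) 0 0 (C 1 2 2) 0 0)"
  proof (rule christoffel_in_chartI[OF open_half_plane])
    show "chart_frame \<phi> \<psi> j p $ k = F j k p" if "p \<in> half_plane" for p j k
    proof (rule chart_frame_nth)
      have "exp (\<phi> p $ 1) = p $ 1" using that by (simp add: \<phi>_def half_plane_def)
      then show "has_partials (\<lambda>y. \<psi> y $ k) (F 1 k p) (F 2 k p) (\<phi> p)" for k
        using exhaust_2[of k] unfolding \<psi>_def F_def
        by (elim disjE; simp)
          (rule has_partials_eqI, (rule has_partials_exp has_partials_raw_intros | (simp; fail))+)+
    qed
    show "has_partials (F j k) (F1 j k) 0 p" for p j k
      unfolding F_def F1_def using exhaust_2[of j] exhaust_2[of k]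
      by (elim disjE; simp)
        (rule has_partials_eqI, (rule has_partials_exp has_partials_raw_intros | (simp; fail))+)+
    show "F i 1 p * F1 j k + F i 2 p * 0
      + (\<Sum>l\<in>UNIV. \<Sum>m\<in>UNIV. F i l p * F j m p * type_B_connection C p l m k)
      = (\<Sum>l\<in>UNIV. sym_coeffs (1 + C 1 1 1) 0 0 (C 1 2 2) 0 0 i j l * F l k p)"
      if "p \<in> half_plane" for p i j k
      using exhaust_2[of i] exhaust_2[of j] exhaust_2[of k] that
      by (auto simp: sum_2 type_B_connection_def F_def F1_def sym_coeffs_def half_plane_def 0 C[of 2 1] k0
        field_simps)
  qed
  ultimately show ?thesis by blast
next
  case True
  define \<phi> :: "point \<Rightarrow> point" where "\<phi> p = vector [ln (p $ 1), p $ 2 * (1 / p $ 1)]" for p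
  define \<psi> :: "point \<Rightarrow> point" where "\<psi> y = vector [exp (y $ 1), y $ 2 * exp (y $ 1)]" for y
  have \<psi>\<phi>: "\<psi> (\<phi> p) = p" if "p \<in> half_plane" for p
    using that by (simp add: \<phi>_def \<psi>_def vec_eq_iff forall_2 half_plane_def)
  have \<phi>\<psi>: "\<phi> (\<psi> y) = y" "\<psi> y \<in> half_plane" for y
    by (simp_all add: \<phi>_def \<psi>_def vec_eq_iff forall_2 half_plane_def)
  have im: "\<phi> ` half_plane = UNIV" using \<phi>\<psi> by (metis UNIV_eq_I image_eqI)
  have "elementary half_plane (\<lambda>p. \<phi> p $ k)" "elementary UNIV (\<lambda>p. \<psi> p $ k)" for k
    using exhaust_2[of k]
    by (auto simp: \<phi>_def \<psi>_def simp del: times_divide_eq_right intro!: elementary.intros)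
  then have "chart half_plane \<phi> \<psi>"
    unfolding chart_def im using open_half_plane \<psi>\<phi> elementary_vec_smooth by auto
  moreover
  \<comment> \<open>The first frame field is now the Euler field
    \<open>x\<^sup>1 \<partial>\<^sub>1 + x\<^sup>2 \<partial>\<^sub>2\<close>, the second is
    \<open>x\<^sup>1 \<partial>\<^sub>2\<close>.\<close>
  define F :: "2 \<Rightarrow> 2 \<Rightarrow> point \<Rightarrow> real" where "F j k p = (if j = 1 then p $ k
    else if k = 1 then 0 else p $ 1)" for j k p
  define F1 :: "2 \<Rightarrow> 2 \<Rightarrow> real" where "F1 j k = (if j \<noteq> k then 0 else 1)" for j k
  define F2 :: "2 \<Rightarrow> 2 \<Rightarrow> real" where "F2 j k = (if j = 1 \<and> k = 2 then 1 else 0)" for j k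
  have "christoffel_in_chart (type_B_connection C) half_plane \<phi> \<psi>
    (\<lambda>_. sym_coeffs (1 + C 1 1 1) (C 1 1 2) 0 (1 + C 1 2 2) 0 0)"
  proof (rule christoffel_in_chartI[OF open_half_plane])
    show "chart_frame \<phi> \<psi> j p $ k = F j k p" if "p \<in> half_plane" for p j k
    proof (rule chart_frame_nth)
      have "exp (\<phi> p $ 1) = p $ 1" "\<phi> p $ 2 * p $ 1 = p $ 2"
        using that by (simp_all add: \<phi>_def half_plane_def)
      then show "has_partials (\<lambda>y. \<psi> y $ k) (F 1 k p) (F 2 k p) (\<phi> p)" for k
        using exhaust_2[of k] unfolding \<psi>_def F_def
        by (elim disjE; simp)
          (rule has_partials_eqI, (rule has_partials_exp has_partials_raw_intros | (simp; fail))+)+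
    qed
    show "has_partials (F j k) (F1 j k) (F2 j k) p" for p j k
      using exhaust_2[of j] exhaust_2[of k]
      unfolding F_def F1_def F2_def
      by (elim disjE; simp)
        (rule has_partials_eqI, (rule has_partials_exp has_partials_raw_intros | (simp; fail))+)+
    show "F i 1 p * F1 j k + F i 2 p * F2 j k
      + (\<Sum>l\<in>UNIV. \<Sum>m\<in>UNIV. F i l p * F j m p * type_B_connection C p l m k)
      = (\<Sum>l\<in>UNIV. sym_coeffs (1 + C 1 1 1) (C 1 1 2) 0 (1 + C 1 2 2) 0 0 i j l * F l k p)"
      if "p \<in> half_plane" for p i j k
      using exhaust_2[of i] exhaust_2[of j] exhaust_2[of k] that
      by (auto simp: sum_2 type_B_connection_def F_def F1_def F2_def sym_coeffs_def half_plane_def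
          0 C[of 2 1] True field_simps)
  qed
  ultimately show ?thesis by blast
qed

lemma type_A_type_B_iff:
  assumes C: "\<And>i j k. C i j k = C j i k"
    and nf: "\<not> flat_on half_plane (type_B_connection C)"
  shows "type_A half_plane (type_B_connection C) \<longleftrightarrow> C 1 2 1 = 0 \<and> C 2 2 1 = 0 \<and> C 2 2 2 = 0"
proof
  assume "C 1 2 1 = 0 \<and> C 2 2 1 = 0 \<and> C 2 2 2 = 0"
  then show "type_A half_plane (type_B_connection C)"
    unfolding type_A_def using nf locally_homogeneous_type_B constant_christoffel_chart[of C] C
    by (metis order_refl)
qed (use type_A_imp_coeffs[of C] C nf in blast)

subsection \<open>The soliton equation\<close>

text \<open>The parameters \<open>p\<close> to \<open>v\<close> are the six coefficients of
  \<open>C\<close>, and \<open>m\<close> is the off-diagonal entry of the symmetrised Ricci matrix.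
  The summands 1 come from the factor \<open>x\<^sup>1\<close> in \<open>g1\<close> and
  \<open>g2\<close>.\<close>

locale soliton_system =
  fixes p q s t u v r11 m r22 :: real and g1 g2 :: "point \<Rightarrow> real"
  assumes d1: "\<And>z. z \<in> half_plane \<Longrightarrow> has_partials g1
      (((p + 1) * g1 z + q * g2 z - r11) / z $ 1) ((s * g1 z + t * g2 z - m) / z $ 1) z"
    and d2: "\<And>z. z \<in> half_plane \<Longrightarrow> has_partials g2
      ((s * g1 z + (t + 1) * g2 z - m) / z $ 1) ((u * g1 z + v * g2 z - r22) / z $ 1) z"
begin

definition rel :: "real \<Rightarrow> real \<Rightarrow> real \<Rightarrow> bool" where
  "rel \<alpha> \<beta> \<kappa> \<longleftrightarrow> (\<forall>z\<in>half_plane. \<alpha> * g1 z + \<beta> * g2 z = \<kappa>)"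

text \<open>The condition that \<open>g1 = \<gamma>\<close>, \<open>g2 = 0\<close> solves the
  system, that is, that \<open>\<gamma> ln x\<^sup>1\<close> is a soliton.\<close>

definition log_soliton :: bool where
  "log_soliton \<longleftrightarrow> (\<exists>\<gamma>. (p + 1) * \<gamma> = r11 \<and> s * \<gamma> = m \<and> u * \<gamma> = r22)"

lemma log_solitonI: "(p + 1) * \<gamma> = r11 \<Longrightarrow> s * \<gamma> = m \<Longrightarrow> u * \<gamma> = r22 \<Longrightarrow> log_soliton"
  unfolding log_soliton_def by blast

lemma log_solitonD: "log_soliton \<Longrightarrow> \<exists>\<gamma>. (p + 1) * \<gamma> = r11 \<and> s * \<gamma> = m \<and> u * \<gamma> = r22"
  unfolding log_soliton_def .

text \<open>Both partial derivatives of a constant combination of \<open>g1\<close> and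
  \<open>g2\<close> vanish, and the system expresses them as affine functions of \<open>g1\<close>
  and \<open>g2\<close> over \<open>x\<^sup>1\<close>.\<close>

lemma rel_derive:
  assumes "rel \<alpha> \<beta> \<kappa>"
  shows "rel (\<alpha> * (p + 1) + \<beta> * s) (\<alpha> * q + \<beta> * (t + 1)) (\<alpha> * r11 + \<beta> * m)"
    and "rel (\<alpha> * s + \<beta> * u) (\<alpha> * t + \<beta> * v) (\<alpha> * m + \<beta> * r22)"
proof -
  have "(\<alpha> * (p + 1) + \<beta> * s) * g1 z + (\<alpha> * q + \<beta> * (t + 1)) * g2 z = \<alpha> * r11 + \<beta> * m \<and>
      (\<alpha> * s + \<beta> * u) * g1 z + (\<alpha> * t + \<beta> * v) * g2 z = \<alpha> * m + \<beta> * r22"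
    if z: "z \<in> half_plane" for z
  proof -
    have 1: "has_partials (\<lambda>z. \<alpha> * g1 z + \<beta> * g2 z)
      ((\<alpha> * ((p + 1) * g1 z + q * g2 z - r11) + \<beta> * (s * g1 z + (t + 1) * g2 z - m)) / z $ 1)
      ((\<alpha> * (s * g1 z + t * g2 z - m) + \<beta> * (u * g1 z + v * g2 z - r22)) / z $ 1) z"
      by (rule has_partials_eqI, (rule d1[OF z] d2[OF z] has_partials_raw_intros)+)
         (simp_all add: add_divide_distrib)
    have 2: "has_partials (\<lambda>z. \<alpha> * g1 z + \<beta> * g2 z) 0 0 z"
      by (rule has_partials_cong[OF has_partials_const[OF refl refl, of \<kappa>] open_half_plane z])
         (use assms in \<open>simp add: rel_def\<close>)
    have "z $ 1 \<noteq> 0" using z by (simp add: half_plane_def)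
    then show ?thesis using has_partials_unique[OF 1 2] by (simp add: algebra_simps)
  qed
  then show "rel (\<alpha> * (p + 1) + \<beta> * s) (\<alpha> * q + \<beta> * (t + 1)) (\<alpha> * r11 + \<beta> * m)"
    and "rel (\<alpha> * s + \<beta> * u) (\<alpha> * t + \<beta> * v) (\<alpha> * m + \<beta> * r22)"
    by (simp_all add: rel_def)
qed

text \<open>Equality of the mixed derivatives of \<open>g1\<close> and of \<open>g2\<close>,
  multiplied by the square of \<open>x\<^sup>1\<close>.\<close>

lemma rel_integrability:
  shows "rel (s * (p + 1) + t * s - (p + 2) * s - q * u) (s * q + t * (t + 1) - (p + 2) * t - q * v)
      (s * r11 + t * m - (p + 2) * m - q * r22)" (is ?A)
    and "rel (u * (p + 1) + v * s - s * s - (t + 2) * u) (u * q + v * (t + 1) - s * t - (t + 2) * v)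
      (u * r11 + v * m - s * m - (t + 2) * r22)" (is ?B)
proof -
  have e1: "(s * (p + 1) + t * s - (p + 2) * s - q * u) * g1 z
      + (s * q + t * (t + 1) - (p + 2) * t - q * v) * g2 z
      = s * r11 + t * m - (p + 2) * m - q * r22" if z: "z \<in> half_plane" for z
  proof -
    have x: "z $ 1 \<noteq> 0" using z by (simp add: half_plane_def)
    have "(s * ((p + 1) * g1 z + q * g2 z - r11) + t * (s * g1 z + (t + 1) * g2 z - m)
      - (s * g1 z + t * g2 z - m)) / (z $ 1)\<^sup>2 =
      ((p + 1) * (s * g1 z + t * g2 z - m) + q * (u * g1 z + v * g2 z - r22)) / (z $ 1)\<^sup>2"
      by (rule has_partials_commute_eqI[OF open_half_plane z d1],
          (rule d1[OF z] d2[OF z] has_partials_raw_intros x | assumption)+)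
         (use x in \<open>simp add: field_simps power2_eq_square\<close>)
    then show ?thesis using x by (simp add: algebra_simps)
  qed
  have e2: "(u * (p + 1) + v * s - s * s - (t + 2) * u) * g1 z
      + (u * q + v * (t + 1) - s * t - (t + 2) * v) * g2 z
      = u * r11 + v * m - s * m - (t + 2) * r22" if z: "z \<in> half_plane" for z
  proof -
    have x: "z $ 1 \<noteq> 0" using z by (simp add: half_plane_def)
    have "(u * ((p + 1) * g1 z + q * g2 z - r11) + v * (s * g1 z + (t + 1) * g2 z - m)
      - (u * g1 z + v * g2 z - r22)) / (z $ 1)\<^sup>2 =
      (s * (s * g1 z + t * g2 z - m) + (t + 1) * (u * g1 z + v * g2 z - r22)) / (z $ 1)\<^sup>2"
      by (rule has_partials_commute_eqI[OF open_half_plane z d2],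
          (rule d1[OF z] d2[OF z] has_partials_raw_intros x | assumption)+)
         (use x in \<open>simp add: field_simps power2_eq_square\<close>)
    then show ?thesis using x by (simp add: algebra_simps)
  qed
  show ?A ?B using e1 e2 by (simp_all add: rel_def)
qed

text \<open>Two independent relations force \<open>g1\<close> and \<open>g2\<close> to be constant, hence \<open>g2 = 0\<close>.\<close>

lemma rel_dichotomy:
  assumes 1: "rel \<alpha> \<beta> \<kappa>" and 2: "rel \<alpha>' \<beta>' \<kappa>'" and nl: "\<not> log_soliton"
  shows "\<alpha> * \<beta>' = \<beta> * \<alpha>'" "\<alpha> * \<kappa>' = \<alpha>' * \<kappa>" "\<beta> * \<kappa>' = \<beta>' * \<kappa>"
proof -
  define z0 :: point where "z0 = (\<chi> i. 1)"
  have z0: "z0 \<in> half_plane" by (simp add: z0_def half_plane_def)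
  show det: "\<alpha> * \<beta>' = \<beta> * \<alpha>'"
  proof (rule ccontr)
    assume det: "\<alpha> * \<beta>' \<noteq> \<beta> * \<alpha>'"
    have 0: "x = 0 \<and> y = 0" if "\<alpha> * x + \<beta> * y = 0" "\<alpha>' * x + \<beta>' * y = 0" for x y
    proof -
      have "(\<alpha> * \<beta>' - \<beta> * \<alpha>') * x = \<beta>' * (\<alpha> * x + \<beta> * y) - \<beta> * (\<alpha>' * x + \<beta>' * y)"
        "(\<alpha> * \<beta>' - \<beta> * \<alpha>') * y = \<alpha> * (\<alpha>' * x + \<beta>' * y) - \<alpha>' * (\<alpha> * x + \<beta> * y)"
        by (simp_all add: algebra_simps)
      then have "(\<alpha> * \<beta>' - \<beta> * \<alpha>') * x = 0" "(\<alpha> * \<beta>' - \<beta> * \<alpha>') * y = 0"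
        using that by simp_all
      with det show ?thesis by simp
    qed
    \<comment> \<open>In each coordinate direction the derived relations say that both independent
      rows annihilate the vector of derivatives of \<open>g1\<close> and \<open>g2\<close>.\<close>
    note D = rel_derive[OF 1] rel_derive[OF 2]
    have "(p + 1) * g1 z0 + q * g2 z0 - r11 = 0 \<and> s * g1 z0 + (t + 1) * g2 z0 - m = 0"
      by (rule 0) (use D(1,3) z0 in \<open>auto simp: rel_def algebra_simps\<close>)
    moreover have "s * g1 z0 + t * g2 z0 - m = 0 \<and> u * g1 z0 + v * g2 z0 - r22 = 0"
      by (rule 0) (use D(2,4) z0 in \<open>auto simp: rel_def algebra_simps\<close>)
    \<comment> \<open>The equations with \<open>t + 1\<close> and with \<open>t\<close> differ
      exactly by \<open>g2 z0\<close>.\<close>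
    ultimately have "g2 z0 = 0" "(p + 1) * g1 z0 = r11 \<and> s * g1 z0 = m \<and> u * g1 z0 = r22"
      by (auto simp: algebra_simps)
    with nl show False unfolding log_soliton_def by blast
  qed
  have k: "\<kappa> = \<alpha> * g1 z0 + \<beta> * g2 z0" "\<kappa>' = \<alpha>' * g1 z0 + \<beta>' * g2 z0"
    using 1 2 z0 by (auto simp: rel_def)
  show "\<alpha> * \<kappa>' = \<alpha>' * \<kappa>" "\<beta> * \<kappa>' = \<beta>' * \<kappa>"
    unfolding k using det by algebra+
qed

text \<open>If \<open>v\<close> were nonzero, the second integrability relation would give
  \<open>g2 = - m\<close>, while its derivative along \<open>x\<^sup>2\<close> gives
  \<open>g2 = 0\<close>; but \<open>m = v / 2\<close>.\<close>

lemma v_eq_0: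
  assumes "s = 0" "u = 0" "m = v / 2" "r22 = 0"
  shows "v = 0"
proof (rule ccontr)
  assume v: "v \<noteq> 0"
  have 1: "rel 0 (- v) (v * m)"
    using rel_integrability(2) unfolding assms(1,2,4) by (simp add: algebra_simps)
  have "\<not> log_soliton" using log_solitonD v assms by auto
  from rel_dichotomy(3)[OF 1 rel_derive(2)[OF 1] this] show False using v assms by simp
qed

text \<open>A log soliton has \<open>\<gamma> = r11 = m\<close> and \<open>r22 = 0\<close>, whence
  \<open>v = 1\<close> and \<open>t - t\<^sup>2 = t\<close>. Without one, the integrability
  relations must be proportional to their derived relations. This leaves \<open>v = 0\<close>, which
  is contradictory, or \<open>v = 1\<close>, which forces \<open>t = - 1\<close> and contradicts the
  first relation.\<close>

lemma normal_form_Q: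
  assumes n: "u = 0" "s = 1" "p = 0"
    and r: "r11 = t + q * v - q - t\<^sup>2" "m = (v + 2 * t - 1) / 2" "r22 = v - 1"
  shows "v = 1 \<and> t = 0"
proof -
  have "log_soliton"
  proof (rule ccontr)
    assume nl: "\<not> log_soliton"
    note L1 = rel_integrability(1)[unfolded n]
    note L2 = rel_integrability(2)[unfolded n]
    have "v * (v - 1)\<^sup>2 = 0"
      using rel_dichotomy(1)[OF L2 rel_derive(2)[OF L2, unfolded n] nl]
      by (simp add: algebra_simps power2_eq_square)
    then consider "v = 0" | "v = 1" by auto
    then show False
    proof cases
      case 1
      show False
        using rel_dichotomy(2)[OF L2 rel_derive(2)[OF L2, unfolded n] nl] r 1
        by (simp add: field_simps)
    next
      case 2
      have "(t + 1) * (t + 1) = 0"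
        using rel_dichotomy(1)[OF L2 rel_derive(1)[OF L2, unfolded n] nl] r 2
        by (simp add: algebra_simps)
      then have "t = - 1" by simp
      then show False
        using rel_dichotomy(1)[OF L1 rel_derive(2)[OF L1, unfolded n] nl] r 2
        by (simp add: algebra_simps)
    qed
  qed
  then obtain \<gamma> where "\<gamma> = r11" "\<gamma> = m" "r22 = 0" using log_solitonD n by auto
  then show ?thesis using r by (auto simp: power2_eq_square)
qed

text \<open>The hypothesis \<open>nz\<close> says that the Ricci tensor is nonzero, which yields a
  nontrivial relation. If there is no log soliton, all other relations are proportional to it;
  solving the resulting equations nevertheless produces a log soliton, with \<gamma> equal to -2 or
  -1/2.\<close>

lemma normal_form_P:
  assumes n: "s = 0" "u = \<epsilon>" and \<epsilon>: "\<epsilon>\<^sup>2 = 1"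
    and r: "r11 = t + p * t + q * v - t\<^sup>2" "m = v / 2 - q * \<epsilon>" "r22 = \<epsilon> * (p - 1 - t)"
    and nz: "\<not> (r11 = 0 \<and> v = q * \<epsilon> \<and> q = 0 \<and> r22 = 0)"
  shows "log_soliton"
proof (rule ccontr)
  assume nl: "\<not> log_soliton"
  have e0: "\<epsilon> \<noteq> 0" using \<epsilon> by auto
  define k1 where "k1 = t * m - (p + 2) * m - q * r22"
  define k2 where "k2 = \<epsilon> * r11 + v * m - (t + 2) * r22"
  \<comment> \<open>The coefficients of \<open>g1\<close> and \<open>g2\<close> in \<open>L1\<close>
    and \<open>L2\<close> are, up to sign, the four Ricci components.\<close>
  have L1: "rel (- q * \<epsilon>) (- r11) k1"
    using rel_integrability(1) unfolding n k1_def r(1) by (simp add: algebra_simps power2_eq_square)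
  have L2: "rel r22 (q * \<epsilon> - v) k2"
    using rel_integrability(2) unfolding n k2_def r(3) by (simp add: algebra_simps power2_eq_square)
  have "r22 \<noteq> 0 \<or> q * \<epsilon> - v \<noteq> 0 \<or> - q * \<epsilon> \<noteq> 0 \<or> - r11 \<noteq> 0"
    using nz e0 by auto
  then obtain \<alpha> \<beta> \<kappa> where R: "rel \<alpha> \<beta> \<kappa>" and ab: "\<alpha> \<noteq> 0 \<or> \<beta> \<noteq> 0"
    using L1 L2 by blast
  note E1 = rel_dichotomy[OF R rel_derive(1)[OF R] nl, unfolded n]
  note E2 = rel_dichotomy[OF R rel_derive(2)[OF R] nl, unfolded n]
  note E3 = rel_dichotomy[OF R L1 nl]
  note E4 = rel_dichotomy[OF R L2 nl]
  show False
  proof (cases "\<beta> = 0")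
    case True
    with ab have a: "\<alpha> \<noteq> 0" by simp
    have q: "q = 0" using E1(1) a True by simp
    have t: "t = 0" using E2(1) a True by simp
    have r11: "r11 = 0" using r(1) q t by simp
    have v: "v = 0" using E4(1) a True q by simp
    have m: "m = 0" using r(2) q v by simp
    have r22: "r22 \<noteq> 0" using nz r11 v q by simp
    have "\<alpha> * (- 2 * r22) = r22 * \<kappa>" using E4(2) by (simp add: k2_def r11 v t)
    then have "r22 * (\<kappa> + 2 * \<alpha>) = 0" by (simp add: algebra_simps)
    then have "\<kappa> = - 2 * \<alpha>" using r22 by simp
    then have "p = - 1" using E1(2) a True r11 by simp
    then have "log_soliton" by (intro log_solitonI[of "- 2"]) (simp_all add: n r11 m r(3) t)
    with nl show False by simp
  next
    case False
    \<comment> \<open>The relation is normalised to \<open>A * g1 + g2 = K\<close>. The equations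
      \<open>f1\<close> to \<open>f6\<close> are the proportionality conditions with the factor
      \<open>\<beta>\<^sup>2\<close> cancelled.\<close>
    define A where "A = \<alpha> / \<beta>"
    define K where "K = \<kappa> / \<beta>"
    have \<alpha>: "\<alpha> = A * \<beta>" and \<kappa>: "\<kappa> = K * \<beta>" using False by (simp_all add: A_def K_def)
    have canc: "x = y" if "x * \<beta> * \<beta> = y * \<beta> * \<beta>" for x y using that False by simp
    have f1: "A * (A * q + (t + 1)) = A * (p + 1)"
      by (rule canc) (use E1(1) in \<open>simp add: \<alpha> algebra_simps\<close>)
    have f2: "A * (A * t + v) = \<epsilon>"
      by (rule canc) (use E2(1) in \<open>simp add: \<alpha> algebra_simps\<close>)
    have f3: "A * (q * \<epsilon> - v) = r22"
      by (rule canc) (use E4(1) in \<open>simp add: \<alpha> algebra_simps\<close>)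
    have f4: "A * r11 + m = (A * q + (t + 1)) * K"
      by (rule canc) (use E1(3) in \<open>simp add: \<alpha> \<kappa> algebra_simps\<close>)
    have f5: "A * (A * m + r22) = \<epsilon> * K"
      by (rule canc) (use E2(2) in \<open>simp add: \<alpha> \<kappa> algebra_simps\<close>)
    have f6: "A * k2 = r22 * K"
      by (rule canc) (use E4(2) in \<open>simp add: \<alpha> \<kappa> algebra_simps\<close>)
    have A: "A \<noteq> 0" using f2 e0 by auto
    have p: "p = A * q + t" using f1 A by simp
    have Av: "A * v = \<epsilon>" using f3 r(3) p by (simp add: algebra_simps)
    have "A * (A * t) = 0" using f2 Av by (simp add: algebra_simps)
    then have t: "t = 0" using A by simp
    define w where "w = A * q"
    have pw: "p = w" using p t by (simp add: w_def)
    have r22: "r22 = \<epsilon> * (w - 1)" using r(3) pw t by simp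
    have qA: "A * (q * v) = q * \<epsilon>" "A * (q * \<epsilon>) = w * \<epsilon>" using Av by (simp_all add: w_def)
    have Am: "A * m = \<epsilon> / 2 - w * \<epsilon>"
      unfolding r(2) Av[symmetric] by (simp add: w_def algebra_simps)
    have "\<epsilon> * (K + A / 2) = 0" using f5 unfolding Am r22 by (simp add: algebra_simps)
    then have K: "K = - A / 2" using e0 by simp
    have "A * r11 + m = v / 2" using r(1,2) t qA(1) by simp
    then have "v / 2 = (w + 1) * K" using f4 t by (simp add: w_def)
    then have g1: "\<epsilon> = - (w + 1) * A\<^sup>2"
      unfolding K Av[symmetric] by (simp add: power2_eq_square algebra_simps)
    have "A * k2 = \<epsilon> * (q * \<epsilon>) + \<epsilon> * (v / 2 - q * \<epsilon>) - 2 * A * r22"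
      unfolding k2_def r(1) using r(2) t qA(1) Av by algebra
    then have "\<epsilon> * (v / 2 - 3 / 2 * A * (w - 1)) = 0"
      using f6 unfolding K r22 by (simp add: field_simps)
    then have v: "v = 3 * A * (w - 1)" using e0 by simp
    have g2: "\<epsilon> = 3 * (w - 1) * A\<^sup>2"
      unfolding Av[symmetric] v by (simp add: power2_eq_square)
    \<comment> \<open>The two expressions for \<epsilon> give
      \<open>- (w + 1) = 3 * (w - 1)\<close>.\<close>
    from g1 g2 have "A\<^sup>2 * (4 * w - 2) = 0" by algebra
    then have w: "w = 1 / 2" using A by simp
    have "A * (A * (q * v + 3 / 4)) = 0"
      using g1 qA w by (simp add: distrib_left) (simp add: power2_eq_square algebra_simps)
    then have "q * v = - 3 / 4" using A by simp
    moreover have "m = 0" using Am w A by simp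
    ultimately have "log_soliton" by (intro log_solitonI[of "- 1 / 2"]) (simp_all add: n r(1) r22 pw t w)
    with nl show False by simp
  qed
qed

end

subsection \<open>Linear equivalence\<close>

lemma matrix_inv_eqI:
  fixes A B :: "'a::semiring_1^'n^'n"
  assumes "A ** B = mat 1" "B ** A = mat 1"
  shows "matrix_inv A = B"
  unfolding matrix_inv_def
proof (rule some_equality)
  fix B' assume "A ** B' = mat 1 \<and> B' ** A = mat 1"
  then have "B' = B' ** (A ** B)" "B' ** A = mat 1" by (simp_all add: assms)
  then show "B' = B" by (metis matrix_mul_assoc matrix_mul_lid)
qed (use assms in simp)

lemma matrix_inv_shear:
  assumes "c \<noteq> 0"
  shows "matrix_inv (shear b c) = vector [vector [1, 0], vector [- b / c, 1 / c]]"
  by (rule matrix_inv_eqI)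
     (use assms in \<open>simp_all add: shear_def matrix_matrix_mult_def mat_def vec_eq_iff forall_2 sum_2\<close>)

lemma shear_nth: "shear b c $ 1 $ 1 = 1" "shear b c $ 1 $ 2 = 0" "shear b c $ 2 $ 1 = b" "shear b c $ 2 $ 2 = c"
  by (simp_all add: shear_def)

lemma matrix_inv_shear_nth:
  assumes "c \<noteq> 0"
  shows "matrix_inv (shear b c) $ 1 $ 1 = 1" "matrix_inv (shear b c) $ 1 $ 2 = 0"
    "matrix_inv (shear b c) $ 2 $ 1 = - b / c" "matrix_inv (shear b c) $ 2 $ 2 = 1 / c"
  by (simp_all add: matrix_inv_shear[OF assms])

lemma linear_pullback_shear:
  fixes C :: coeffs and b c :: real
  assumes C: "\<And>i j k. C i j k = C j i k" and c: "c \<noteq> 0"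
  defines "C' \<equiv> linear_pullback (shear b c) C"
  shows "C' i j k = C' j i k"
    and "C' 1 1 1 = C 1 1 1 + 2 * b * C 1 2 1 + b\<^sup>2 * C 2 2 1"
    and "C' 1 1 2 = (C 1 1 2 + 2 * b * C 1 2 2 + b\<^sup>2 * C 2 2 2
           - b * (C 1 1 1 + 2 * b * C 1 2 1 + b\<^sup>2 * C 2 2 1)) / c"
    and "C' 1 2 1 = c * (C 1 2 1 + b * C 2 2 1)"
    and "C' 1 2 2 = C 1 2 2 + b * C 2 2 2 - b * (C 1 2 1 + b * C 2 2 1)"
    and "C' 2 2 1 = c\<^sup>2 * C 2 2 1"
    and "C' 2 2 2 = c * (C 2 2 2 - b * C 2 2 1)"
  using exhaust_2[of i] exhaust_2[of j] c C[of 2 1]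
  by (auto simp: C'_def linear_pullback_def matrix_inv_shear_nth[OF c] shear_nth sum_2 power2_eq_square
      field_simps)

text \<open>A shear preserves \<open>x\<^sup>1\<close>, so the Ricci coefficients transform as a
  bilinear form.\<close>

lemma ricci_coeff_pullback_shear:
  fixes C :: coeffs and b c :: real
  assumes C: "\<And>i j k. C i j k = C j i k" and c: "c \<noteq> 0"
  defines "C' \<equiv> linear_pullback (shear b c) C"
  shows "ricci_coeff C' 1 1 = ricci_coeff C 1 1 + b * (ricci_coeff C 1 2 + ricci_coeff C 2 1)
      + b\<^sup>2 * ricci_coeff C 2 2"
    and "ricci_coeff C' 1 2 = c * (ricci_coeff C 1 2 + b * ricci_coeff C 2 2)"
    and "ricci_coeff C' 2 1 = c * (ricci_coeff C 2 1 + b * ricci_coeff C 2 2)"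
    and "ricci_coeff C' 2 2 = c\<^sup>2 * ricci_coeff C 2 2"
  using c unfolding C'_def ricci_coeff_eqs[of C, OF C]
    ricci_coeff_eqs[of "linear_pullback (shear b c) C", OF linear_pullback_shear(1)[of C, OF C c]]
    linear_pullback_shear(2-7)[of C, OF C c]
  by (simp_all add: field_simps power2_eq_square)

lemma linear_pullback_id: "linear_pullback (shear 0 1) C = C"
proof (intro ext)
  fix i j k
  show "linear_pullback (shear 0 1) C i j k = C i j k"
    using exhaust_2[of i] exhaust_2[of j] exhaust_2[of k]
    by (auto simp: linear_pullback_def matrix_inv_shear_nth shear_nth sum_2)
qed

lemma coeffs_eqI:
  assumes "\<And>i j k. C i j k = C j i k"
  shows "C = sym_coeffs (C 1 1 1) (C 1 1 2) (C 1 2 1) (C 1 2 2) (C 2 2 1) (C 2 2 2)"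
proof (intro ext)
  fix i j k
  show "C i j k = sym_coeffs (C 1 1 1) (C 1 1 2) (C 1 2 1) (C 1 2 2) (C 2 2 1) (C 2 2 2) i j k"
    using exhaust_2[of i] exhaust_2[of j] exhaust_2[of k] assms[of 2 1]
    by (auto simp: sym_coeffs_def)
qed

section \<open>From solitons to the soliton system\<close>

abbreviation type_B_soliton_system :: "coeffs \<Rightarrow> (point \<Rightarrow> real) \<Rightarrow> (point \<Rightarrow> real) \<Rightarrow> bool" where
  "type_B_soliton_system C \<equiv> soliton_system (C 1 1 1) (C 1 1 2) (C 1 2 1) (C 1 2 2) (C 2 2 1) (C 2 2 2)
     (sym_ricci_coeff C 1 1) (sym_ricci_coeff C 1 2) (sym_ricci_coeff C 2 2)"

lemma sym_ricci_coeff_commute: "sym_ricci_coeff C 2 1 = sym_ricci_coeff C 1 2"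
  by (simp add: sym_ricci_coeff_def)

lemma soliton_imp_system:
  assumes f: "f \<in> solitons half_plane (type_B_connection C)"
    and C: "\<And>i j k. C i j k = C j i k"
  shows "\<exists>g1 g2. type_B_soliton_system C g1 g2"
proof (intro exI)
  define D where "D i = (\<lambda>p. frechet_derivative f (at p) (axis i 1))" for i
  have sm: "smooth_on half_plane f" and
    eq: "\<And>p i j. p \<in> half_plane \<Longrightarrow> frechet_derivative (D j) (at p) (axis i 1)
      = (C i j 1 * D 1 p + C i j 2 * D 2 p) / p $ 1 - sym_ricci_coeff C i j / (p $ 1)\<^sup>2"
    using f unfolding solitons_type_B_iff by (auto simp: D_def sum_2)
  have smD: "smooth_on half_plane (D j)" for j
    unfolding D_def using sm by (rule smooth_on_partial)
  have dD: "has_partials (D j)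
      ((C 1 j 1 * D 1 p + C 1 j 2 * D 2 p) / p $ 1 - sym_ricci_coeff C 1 j / (p $ 1)\<^sup>2)
      ((C 2 j 1 * D 1 p + C 2 j 2 * D 2 p) / p $ 1 - sym_ricci_coeff C 2 j / (p $ 1)\<^sup>2) p"
    if "p \<in> half_plane" for p j
    using smooth_on_has_partials[OF smD open_half_plane that, of j] eq[OF that] by simp
  show "type_B_soliton_system C (\<lambda>p. p $ 1 * D 1 p) (\<lambda>p. p $ 1 * D 2 p)"
  proof
    fix z assume z: "z \<in> half_plane"
    then have x: "z $ 1 \<noteq> 0" by (simp add: half_plane_def)
    show "has_partials (\<lambda>p. p $ 1 * D 1 p)
      (((C 1 1 1 + 1) * (z $ 1 * D 1 z) + C 1 1 2 * (z $ 1 * D 2 z) - sym_ricci_coeff C 1 1) / z $ 1)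
      ((C 1 2 1 * (z $ 1 * D 1 z) + C 1 2 2 * (z $ 1 * D 2 z) - sym_ricci_coeff C 1 2) / z $ 1) z"
      by (rule has_partials_eqI, (rule dD[OF z] has_partials_raw_intros)+)
         (use x in \<open>simp_all add: field_simps power2_eq_square sym_ricci_coeff_commute C[of 2 1]\<close>)
    show "has_partials (\<lambda>p. p $ 1 * D 2 p)
      ((C 1 2 1 * (z $ 1 * D 1 z) + (C 1 2 2 + 1) * (z $ 1 * D 2 z) - sym_ricci_coeff C 1 2) / z $ 1)
      ((C 2 2 1 * (z $ 1 * D 1 z) + C 2 2 2 * (z $ 1 * D 2 z) - sym_ricci_coeff C 2 2) / z $ 1) z"
      by (rule has_partials_eqI, (rule dD[OF z] has_partials_raw_intros)+)
         (use x in \<open>simp_all add: field_simps power2_eq_square\<close>)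
  qed
qed

lemma sym_ricci_coeff_pullback_shear:
  fixes C :: coeffs and b c :: real
  assumes C: "\<And>i j k. C i j k = C j i k" and c: "c \<noteq> 0"
  defines "C' \<equiv> linear_pullback (shear b c) C"
  shows "sym_ricci_coeff C' 1 1 = sym_ricci_coeff C 1 1 + 2 * b * sym_ricci_coeff C 1 2
      + b\<^sup>2 * sym_ricci_coeff C 2 2"
    and "sym_ricci_coeff C' 1 2 = c * (sym_ricci_coeff C 1 2 + b * sym_ricci_coeff C 2 2)"
    and "sym_ricci_coeff C' 2 2 = c\<^sup>2 * sym_ricci_coeff C 2 2"
  unfolding C'_def sym_ricci_coeff_def ricci_coeff_pullback_shear[of C, OF C c]
  by (simp_all add: field_simps)

text \<open>The functions \<open>g1\<close>, \<open>g2\<close> are components of the covector field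
  \<open>x\<^sup>1 df\<close>. As the shear \<open>T\<close> preserves \<open>x\<^sup>1\<close>, the
  solution for the pulled back coefficients is obtained by pulling back this field.\<close>

lemma type_B_soliton_system_pullback:
  fixes C :: coeffs and b c :: real
  assumes C: "\<And>i j k. C i j k = C j i k" and c: "c \<noteq> 0"
    and sys: "type_B_soliton_system C g1 g2"
  shows "\<exists>h1 h2. type_B_soliton_system (linear_pullback (shear b c) C) h1 h2"
proof (intro exI)
  interpret soliton_system "C 1 1 1" "C 1 1 2" "C 1 2 1" "C 1 2 2" "C 2 2 1" "C 2 2 2"
    "sym_ricci_coeff C 1 1" "sym_ricci_coeff C 1 2" "sym_ricci_coeff C 2 2" g1 g2
    by (rule sys)
  define T :: "point \<Rightarrow> point" where "T z = vector [z $ 1, b * z $ 1 + c * z $ 2]" for z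
  have T1: "T z $ 1 = z $ 1" for z by (simp add: T_def)
  have T: "T z \<in> half_plane \<longleftrightarrow> z \<in> half_plane" for z by (simp add: T_def half_plane_def)
  have dT: "(T has_derivative T) (at z)" for z
  proof (rule bounded_linear_imp_has_derivative)
    show "bounded_linear T"
      unfolding linear_conv_bounded_linear[symmetric]
      by (intro linearI) (simp_all add: T_def vec_eq_iff forall_2 algebra_simps)
  qed
  have comp: "has_partials (\<lambda>z. F (T z)) (\<alpha> + b * \<beta>) (c * \<beta>) z"
    if "has_partials F \<alpha> \<beta> (T z)" for F \<alpha> \<beta> z
    using has_derivative_compose[OF dT that[unfolded has_partials_def]]
    by (simp add: has_partials_def T_def algebra_simps)
  show "type_B_soliton_system (linear_pullback (shear b c) C)
    (\<lambda>z. g1 (T z) + b * g2 (T z)) (\<lambda>z. c * g2 (T z))"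
    unfolding sym_ricci_coeff_pullback_shear[of C, OF C c] linear_pullback_shear(2-7)[of C, OF C c]
  proof
    fix z assume "z \<in> half_plane"
    then have z: "T z \<in> half_plane" and x: "z $ 1 \<noteq> 0" by (simp_all add: T1 half_plane_def)
    note d = comp[OF d1[OF z]] comp[OF d2[OF z]]
    show "has_partials (\<lambda>z. g1 (T z) + b * g2 (T z))
      (((C 1 1 1 + 2 * b * C 1 2 1 + b\<^sup>2 * C 2 2 1 + 1) * (g1 (T z) + b * g2 (T z))
        + (C 1 1 2 + 2 * b * C 1 2 2 + b\<^sup>2 * C 2 2 2
           - b * (C 1 1 1 + 2 * b * C 1 2 1 + b\<^sup>2 * C 2 2 1)) / c * (c * g2 (T z))
        - (sym_ricci_coeff C 1 1 + 2 * b * sym_ricci_coeff C 1 2 + b\<^sup>2 * sym_ricci_coeff C 2 2)) / z $ 1)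
      ((c * (C 1 2 1 + b * C 2 2 1) * (g1 (T z) + b * g2 (T z))
        + (C 1 2 2 + b * C 2 2 2 - b * (C 1 2 1 + b * C 2 2 1)) * (c * g2 (T z))
        - c * (sym_ricci_coeff C 1 2 + b * sym_ricci_coeff C 2 2)) / z $ 1) z"
      by (rule has_partials_eqI, (rule d has_partials_raw_intros)+)
         (use x c in \<open>simp_all add: T1 field_simps power2_eq_square\<close>)
    show "has_partials (\<lambda>z. c * g2 (T z))
      ((c * (C 1 2 1 + b * C 2 2 1) * (g1 (T z) + b * g2 (T z))
        + (C 1 2 2 + b * C 2 2 2 - b * (C 1 2 1 + b * C 2 2 1) + 1) * (c * g2 (T z))
        - c * (sym_ricci_coeff C 1 2 + b * sym_ricci_coeff C 2 2)) / z $ 1)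
      ((c\<^sup>2 * C 2 2 1 * (g1 (T z) + b * g2 (T z)) + c * (C 2 2 2 - b * C 2 2 1) * (c * g2 (T z))
        - c\<^sup>2 * sym_ricci_coeff C 2 2) / z $ 1) z"
      by (rule has_partials_eqI, (rule d has_partials_raw_intros)+)
         (use x c in \<open>simp_all add: T1 field_simps power2_eq_square\<close>)
  qed
qed

lemma has_partials_frechet:
  assumes "has_partials f a b p"
  shows "frechet_derivative f (at p) (axis 1 1) = a" "frechet_derivative f (at p) (axis 2 1) = b"
  using frechet_derivative_at[OF assms[unfolded has_partials_def], symmetric]
  by (simp_all add: axis_def)

section \<open>Explicit solitons\<close>

lemma solitons_type_B_I:
  assumes C: "\<And>i j k. C i j k = C j i k" and sm: "smooth_on half_plane f"
    and d: "\<And>p. p \<in> half_plane \<Longrightarrow> has_partials f (f1 p) (f2 p) p"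
    and d1: "\<And>p. p \<in> half_plane \<Longrightarrow> has_partials f1
      ((C 1 1 1 * f1 p + C 1 1 2 * f2 p) / p $ 1 - sym_ricci_coeff C 1 1 / (p $ 1)\<^sup>2)
      ((C 1 2 1 * f1 p + C 1 2 2 * f2 p) / p $ 1 - sym_ricci_coeff C 1 2 / (p $ 1)\<^sup>2) p"
    and d2: "\<And>p. p \<in> half_plane \<Longrightarrow> has_partials f2
      ((C 1 2 1 * f1 p + C 1 2 2 * f2 p) / p $ 1 - sym_ricci_coeff C 1 2 / (p $ 1)\<^sup>2)
      ((C 2 2 1 * f1 p + C 2 2 2 * f2 p) / p $ 1 - sym_ricci_coeff C 2 2 / (p $ 1)\<^sup>2) p"
  shows "f \<in> solitons half_plane (type_B_connection C)"
  unfolding solitons_type_B_iff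
proof (intro conjI sm ballI allI)
  fix p i j assume p: "p \<in> half_plane"
  have e: "has_partials (\<lambda>q. frechet_derivative f (at q) (axis 1 1)) a b p"
    if "has_partials f1 a b p" for a b
    by (rule has_partials_cong[OF that open_half_plane p]) (simp add: has_partials_frechet[OF d])
  have e': "has_partials (\<lambda>q. frechet_derivative f (at q) (axis 2 1)) a b p"
    if "has_partials f2 a b p" for a b
    by (rule has_partials_cong[OF that open_half_plane p]) (simp add: has_partials_frechet[OF d])
  show "frechet_derivative (\<lambda>q. frechet_derivative f (at q) (axis j 1)) (at p) (axis i 1)
      = (\<Sum>k\<in>UNIV. C i j k * frechet_derivative f (at p) (axis k 1)) / p $ 1
        - sym_ricci_coeff C i j / (p $ 1)\<^sup>2"
    using exhaust_2[of i] exhaust_2[of j] has_partials_frechet[OF e[OF d1[OF p]]]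
      has_partials_frechet[OF e'[OF d2[OF p]]] C[of 2 1] sym_ricci_coeff_commute[of C]
    by (auto simp: sum_2 has_partials_frechet[OF d[OF p]])
qed

lemma log_soliton_in_solitons:
  assumes C: "\<And>i j k. C i j k = C j i k"
    and "(C 1 1 1 + 1) * \<gamma> = sym_ricci_coeff C 1 1" "C 1 2 1 * \<gamma> = sym_ricci_coeff C 1 2"
      "C 2 2 1 * \<gamma> = sym_ricci_coeff C 2 2"
  shows "(\<lambda>p. \<gamma> * ln (p $ 1)) \<in> solitons half_plane (type_B_connection C)"
proof (rule solitons_type_B_I[OF C])
  show "smooth_on half_plane (\<lambda>p. \<gamma> * ln (p $ 1))"
    by (intro elementary_smooth open_half_plane elementary.intros order_refl)
  fix p assume "p \<in> half_plane"
  then have x: "p $ 1 > 0" "p $ 1 \<noteq> 0" by (simp_all add: half_plane_def)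
  show "has_partials (\<lambda>p. \<gamma> * ln (p $ 1)) (\<gamma> / p $ 1) 0 p"
    by (rule has_partials_eqI, (rule has_partials_ln has_partials_raw_intros x)+) (use x in simp_all)
  show "has_partials (\<lambda>p. \<gamma> / p $ 1)
      ((C 1 1 1 * (\<gamma> / p $ 1) + C 1 1 2 * 0) / p $ 1 - sym_ricci_coeff C 1 1 / (p $ 1)\<^sup>2)
      ((C 1 2 1 * (\<gamma> / p $ 1) + C 1 2 2 * 0) / p $ 1 - sym_ricci_coeff C 1 2 / (p $ 1)\<^sup>2) p"
    unfolding assms(2-4)[symmetric]
    by (rule has_partials_eqI, (rule has_partials_raw_intros x)+)
       (use x in \<open>simp_all add: field_simps power2_eq_square\<close>)
  show "has_partials (\<lambda>p. 0)
      ((C 1 2 1 * (\<gamma> / p $ 1) + C 1 2 2 * 0) / p $ 1 - sym_ricci_coeff C 1 2 / (p $ 1)\<^sup>2)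
      ((C 2 2 1 * (\<gamma> / p $ 1) + C 2 2 2 * 0) / p $ 1 - sym_ricci_coeff C 2 2 / (p $ 1)\<^sup>2) p"
    unfolding assms(2-4)[symmetric]
    by (rule has_partials_const) (use x in \<open>simp_all add: field_simps power2_eq_square\<close>)
qed

text \<open>The resonant case \<open>p + 1 = 0\<close>: the equation for a function of
  \<open>x\<^sup>1\<close> alone becomes \<open>x\<^sup>1 \<partial>\<^sub>1 g1 = - r11\<close>,
  solved by \<open>g1 = - r11 ln x\<^sup>1\<close>.\<close>

lemma log_squared_in_solitons:
  assumes C: "\<And>i j k. C i j k = C j i k" and "C 1 1 1 = - 1" "C 1 2 1 = 0" "C 2 2 1 = 0"
    and "sym_ricci_coeff C 1 2 = 0" "sym_ricci_coeff C 2 2 = 0"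
  shows "(\<lambda>p. - sym_ricci_coeff C 1 1 / 2 * (ln (p $ 1) * ln (p $ 1)))
    \<in> solitons half_plane (type_B_connection C)"
proof (rule solitons_type_B_I[OF C])
  let ?r = "sym_ricci_coeff C 1 1"
  show "smooth_on half_plane (\<lambda>p. - ?r / 2 * (ln (p $ 1) * ln (p $ 1)))"
    by (intro elementary_smooth open_half_plane elementary.intros order_refl)
  fix p assume "p \<in> half_plane"
  then have x: "p $ 1 > 0" "p $ 1 \<noteq> 0" by (simp_all add: half_plane_def)
  show "has_partials (\<lambda>p. - ?r / 2 * (ln (p $ 1) * ln (p $ 1))) (- ?r * ln (p $ 1) / p $ 1) 0 p"
    by (rule has_partials_eqI, rule has_partials_mult[OF has_partials_const[OF refl refl] _ refl refl],
        (rule has_partials_ln has_partials_raw_intros x)+) (use x in simp_all)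
  show "has_partials (\<lambda>p. - ?r * ln (p $ 1) / p $ 1)
      ((C 1 1 1 * (- ?r * ln (p $ 1) / p $ 1) + C 1 1 2 * 0) / p $ 1 - ?r / (p $ 1)\<^sup>2)
      ((C 1 2 1 * (- ?r * ln (p $ 1) / p $ 1) + C 1 2 2 * 0) / p $ 1 - sym_ricci_coeff C 1 2 / (p $ 1)\<^sup>2) p"
    unfolding assms(2-6)
    by (rule has_partials_eqI, (rule has_partials_ln has_partials_raw_intros x)+)
       (use x in \<open>simp_all add: field_simps power2_eq_square\<close>)
  show "has_partials (\<lambda>p. 0)
      ((C 1 2 1 * (- ?r * ln (p $ 1) / p $ 1) + C 1 2 2 * 0) / p $ 1 - sym_ricci_coeff C 1 2 / (p $ 1)\<^sup>2)
      ((C 2 2 1 * (- ?r * ln (p $ 1) / p $ 1) + C 2 2 2 * 0) / p $ 1 - sym_ricci_coeff C 2 2 / (p $ 1)\<^sup>2) p"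
    unfolding assms(2-6) by (rule has_partials_const) simp_all
qed

subsection \<open>Normal forms\<close>

lemma type_A_coeffs_solitons_nonempty:
  assumes C: "\<And>i j k. C i j k = C j i k" and 0: "C 1 2 1 = 0" "C 2 2 1 = 0" "C 2 2 2 = 0"
  shows "solitons half_plane (type_B_connection C) \<noteq> {}"
proof -
  have r: "sym_ricci_coeff C 1 2 = 0" "sym_ricci_coeff C 2 2 = 0"
    unfolding sym_ricci_coeff_def ricci_coeff_eqs[of C, OF C] 0 by simp_all
  show ?thesis
  proof (cases "C 1 1 1 = - 1")
    case True
    show ?thesis using log_squared_in_solitons[of C, OF C True 0(1,2) r] by blast
  next
    case False
    then have "(C 1 1 1 + 1) * (sym_ricci_coeff C 1 1 / (C 1 1 1 + 1)) = sym_ricci_coeff C 1 1"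
      by (simp add: add_eq_0_iff2)
    then show ?thesis
      using log_soliton_in_solitons[of C "sym_ricci_coeff C 1 1 / (C 1 1 1 + 1)", OF C] 0 r by auto
  qed
qed

text \<open>Shears leave \<open>ln x\<^sup>1\<close> unchanged, so the equations descend with the
  same \<gamma>; they are recovered from the \<open>22\<close> entry upwards.\<close>

lemma log_soliton_pullback_shear:
  fixes C :: coeffs and b c :: real
  assumes C: "\<And>i j k. C i j k = C j i k" and c: "c \<noteq> 0"
  defines "C' \<equiv> linear_pullback (shear b c) C"
  assumes l: "(C' 1 1 1 + 1) * \<gamma> = sym_ricci_coeff C' 1 1" "C' 1 2 1 * \<gamma> = sym_ricci_coeff C' 1 2"
      "C' 2 2 1 * \<gamma> = sym_ricci_coeff C' 2 2"
  shows "(C 1 1 1 + 1) * \<gamma> = sym_ricci_coeff C 1 1" "C 1 2 1 * \<gamma> = sym_ricci_coeff C 1 2"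
      "C 2 2 1 * \<gamma> = sym_ricci_coeff C 2 2"
proof -
  note p = linear_pullback_shear(2-7)[of C, OF C c] sym_ricci_coeff_pullback_shear[of C, OF C c]
  show 3: "C 2 2 1 * \<gamma> = sym_ricci_coeff C 2 2"
    using l(3) c unfolding C'_def p by simp
  have "c * ((C 1 2 1 + b * C 2 2 1) * \<gamma>) = c * (sym_ricci_coeff C 1 2 + b * (C 2 2 1 * \<gamma>))"
    using l(2) unfolding C'_def p 3 by (simp add: mult.assoc)
  then show 2: "C 1 2 1 * \<gamma> = sym_ricci_coeff C 1 2"
    using c by (simp add: algebra_simps)
  show "(C 1 1 1 + 1) * \<gamma> = sym_ricci_coeff C 1 1"
    using l(1) unfolding C'_def p 2[symmetric] 3[symmetric] by (simp add: algebra_simps)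
qed

lemma P_coeffs_log_soliton:
  assumes "\<epsilon>\<^sup>2 = 1" and "C = P_coeffs \<epsilon> a c"
  shows "(C 1 1 1 + 1) * a = sym_ricci_coeff C 1 1" "C 1 2 1 * a = sym_ricci_coeff C 1 2"
      "C 2 2 1 * a = sym_ricci_coeff C 2 2"
proof -
  have C: "C i j k = C j i k" for i j k
    by (simp add: assms P_coeffs_def sym_coeffs_def)
  have v: "C 1 1 1 = (a\<^sup>2 + 4 * a - \<epsilon> * (2 * c\<^sup>2) + 2) / 2" "C 1 1 2 = c" "C 1 2 1 = 0"
    "C 1 2 2 = (a\<^sup>2 + 2 * a - \<epsilon> * (2 * c\<^sup>2)) / 2" "C 2 2 1 = \<epsilon>" "C 2 2 2 = \<epsilon> * (2 * c)"
    by (simp_all add: assms P_coeffs_def sym_coeffs_def)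
  show "(C 1 1 1 + 1) * a = sym_ricci_coeff C 1 1" "C 1 2 1 * a = sym_ricci_coeff C 1 2"
      "C 2 2 1 * a = sym_ricci_coeff C 2 2"
    unfolding sym_ricci_coeff_def ricci_coeff_eqs[of C, OF C] v
    by (simp_all add: field_simps power2_eq_square)
qed

text \<open>The symmetrised Ricci tensor vanishes, so constants are solitons.\<close>

lemma Q_coeffs_log_soliton:
  assumes "C = Q_coeffs c"
  shows "(C 1 1 1 + 1) * 0 = sym_ricci_coeff C 1 1" "C 1 2 1 * 0 = sym_ricci_coeff C 1 2"
      "C 2 2 1 * 0 = sym_ricci_coeff C 2 2"
proof -
  have C: "C i j k = C j i k" for i j k
    by (simp add: assms Q_coeffs_def sym_coeffs_def)
  have v: "C 1 1 1 = 0" "C 1 1 2 = c" "C 1 2 1 = 1" "C 1 2 2 = 0" "C 2 2 1 = 0" "C 2 2 2 = 1"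
    by (simp_all add: assms Q_coeffs_def sym_coeffs_def)
  show "(C 1 1 1 + 1) * 0 = sym_ricci_coeff C 1 1" "C 1 2 1 * 0 = sym_ricci_coeff C 1 2"
      "C 2 2 1 * 0 = sym_ricci_coeff C 2 2"
    unfolding sym_ricci_coeff_def ricci_coeff_eqs[of C, OF C] v by simp_all
qed

lemma solitons_nonempty_if_normal_form:
  assumes C: "\<And>i j k. C i j k = C j i k" and "linearly_equivalent C C'"
    and "type_A half_plane (type_B_connection C')
      \<or> (\<exists>a c. C' = P_coeffs 1 a c \<or> C' = P_coeffs (- 1) a c) \<or> (\<exists>c. C' = Q_coeffs c)"
  shows "solitons half_plane (type_B_connection C) \<noteq> {}"
proof -
  obtain b c where c: "c \<noteq> 0" and C': "C' = linear_pullback (shear b c) C"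
    using assms(2) unfolding linearly_equivalent_def by blast
  note pull = linear_pullback_shear[of C, OF C c, of b, folded C']
  have log: ?thesis if "(C' 1 1 1 + 1) * \<gamma> = sym_ricci_coeff C' 1 1"
    "C' 1 2 1 * \<gamma> = sym_ricci_coeff C' 1 2" "C' 2 2 1 * \<gamma> = sym_ricci_coeff C' 2 2" for \<gamma>
    using log_soliton_in_solitons[of C \<gamma>, OF C log_soliton_pullback_shear[of C, OF C c that[unfolded C']]]
    by blast
  consider "type_A half_plane (type_B_connection C')" | \<epsilon> a c where "\<epsilon>\<^sup>2 = 1" "C' = P_coeffs \<epsilon> a c"
    | c where "C' = Q_coeffs c"
    using assms(3) by (metis one_power2 power2_minus)
  then show ?thesis
  proof cases
    case 1
    then have "\<not> flat_on half_plane (type_B_connection C')" by (simp add: type_A_def)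
    from type_A_imp_coeffs[of C', OF pull(1) this 1]
    \<comment> \<open>The simultaneous vanishing of these three coefficients is invariant under
      shears.\<close>
    have "C 1 2 1 = 0" "C 2 2 1 = 0" "C 2 2 2 = 0" using c by (auto simp: pull)
    then show ?thesis using type_A_coeffs_solitons_nonempty[of C] C by blast
  next
    case (2 \<epsilon> a c)
    show ?thesis by (rule log[OF P_coeffs_log_soliton[OF 2]])
  next
    case (3 c)
    show ?thesis by (rule log[OF Q_coeffs_log_soliton[OF 3]])
  qed
qed

text \<open>The cases are invariant under shears: \<open>C 2 2 1 \<noteq> 0\<close> leads to
  \<open>P_coeffs\<close>; \<open>C 2 2 1 = 0\<close> with \<open>C 1 2 1 \<noteq> 0\<close> leads
  to \<open>Q_coeffs\<close>; if both vanish, the soliton forces Type A.\<close>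

lemma soliton_imp_normal_form:
  assumes C: "\<And>i j k. C i j k = C j i k"
    and nf: "\<not> flat_on half_plane (type_B_connection C)"
    and f: "f \<in> solitons half_plane (type_B_connection C)"
  shows "\<exists>C'. linearly_equivalent C C' \<and> (type_A half_plane (type_B_connection C')
      \<or> (\<exists>a c. (a, c) \<noteq> (0, 0) \<and> c \<ge> 0 \<and> (C' = P_coeffs 1 a c \<or> C' = P_coeffs (- 1) a c))
      \<or> (\<exists>c. C' = Q_coeffs c))"
proof -
  obtain g1 g2 where sys: "type_B_soliton_system C g1 g2"
    using soliton_imp_system[OF f] C by blast
  have lin: "linearly_equivalent C (linear_pullback (shear b c) C)" if "c \<noteq> 0" for b c
    using that unfolding linearly_equivalent_def by blast
  consider "C 2 2 1 \<noteq> 0" | "C 2 2 1 = 0" "C 1 2 1 \<noteq> 0" | "C 2 2 1 = 0" "C 1 2 1 = 0" by blast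
  then show ?thesis
  proof cases
    case 1
    \<comment> \<open>\<open>b\<close> removes \<open>C' 1 2 1\<close>, the size of \<open>c\<close>
      normalises \<open>C' 2 2 1\<close> to its sign, and the sign of \<open>c\<close> makes
      \<open>C' 1 1 2 = n / c\<close> nonnegative.\<close>
    define b where "b = - C 1 2 1 / C 2 2 1"
    define n where "n = C 1 1 2 + 2 * b * C 1 2 2 + b\<^sup>2 * C 2 2 2
           - b * (C 1 1 1 + 2 * b * C 1 2 1 + b\<^sup>2 * C 2 2 1)"
    define c0 where "c0 = 1 / sqrt \<bar>C 2 2 1\<bar>"
    define c where "c = (if n \<ge> 0 then c0 else - c0)"
    define \<epsilon> where "\<epsilon> = sgn (C 2 2 1)"
    have c0: "c0 > 0" using 1 by (simp add: c0_def)
    have c: "c \<noteq> 0" "n / c \<ge> 0" using c0 by (auto simp: c_def divide_nonpos_pos)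
    have "c\<^sup>2 = 1 / \<bar>C 2 2 1\<bar>" by (simp add: c_def c0_def power_divide)
    then have \<epsilon>: "c\<^sup>2 * C 2 2 1 = \<epsilon>" "\<epsilon> = 1 \<or> \<epsilon> = - 1"
      using 1 by (auto simp: \<epsilon>_def sgn_if)
    then have \<epsilon>2: "\<epsilon>\<^sup>2 = 1" by auto
    define C' where "C' = linear_pullback (shear b c) C"
    note pull = linear_pullback_shear[of C, OF C c(1), of b, folded C'_def]
    have C'0: "C' 1 2 1 = 0" "C' 2 2 1 = \<epsilon>" "C' 1 1 2 \<ge> 0"
      using 1 \<epsilon>(1) c(2) unfolding pull n_def by (simp_all add: b_def)
    note r = ricci_coeff_eqs[of C', OF pull(1), unfolded C'0]
    have nonflat: "\<not> (\<forall>j k. ricci_coeff C' j k = 0)"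
    proof
      assume 0: "\<forall>j k. ricci_coeff C' j k = 0"
      note R = ricci_coeff_pullback_shear[of C, OF C c(1), of b, folded C'_def, unfolded 0[rule_format]]
      have "ricci_coeff C j k = 0" for j k
        using R c(1) exhaust_2[of j] exhaust_2[of k] by auto
      then show False using nf flat_on_if_ricci_coeff_0[of C, OF C] by blast
    qed
    obtain h1 h2 where "type_B_soliton_system C' h1 h2"
      using type_B_soliton_system_pullback[of C, OF C c(1) sys] unfolding C'_def by blast
    then interpret soliton_system "C' 1 1 1" "C' 1 1 2" "C' 1 2 1" "C' 1 2 2" "C' 2 2 1" "C' 2 2 2"
      "sym_ricci_coeff C' 1 1" "sym_ricci_coeff C' 1 2" "sym_ricci_coeff C' 2 2" h1 h2 .
    have R: "sym_ricci_coeff C' 1 1 = C' 1 2 2 + C' 1 1 1 * C' 1 2 2 + C' 1 1 2 * C' 2 2 2 - (C' 1 2 2)\<^sup>2"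
      "sym_ricci_coeff C' 1 2 = C' 2 2 2 / 2 - C' 1 1 2 * \<epsilon>"
      "sym_ricci_coeff C' 2 2 = \<epsilon> * (C' 1 1 1 - 1 - C' 1 2 2)"
      by (simp_all add: sym_ricci_coeff_def r field_simps)
    have "log_soliton"
    proof (rule normal_form_P[OF C'0(1,2) \<epsilon>2 R])
      show "\<not> (sym_ricci_coeff C' 1 1 = 0 \<and> C' 2 2 2 = C' 1 1 2 * \<epsilon> \<and> C' 1 1 2 = 0
        \<and> sym_ricci_coeff C' 2 2 = 0)"
      proof
        assume 0: "sym_ricci_coeff C' 1 1 = 0 \<and> C' 2 2 2 = C' 1 1 2 * \<epsilon> \<and> C' 1 1 2 = 0
          \<and> sym_ricci_coeff C' 2 2 = 0"
        have "ricci_coeff C' 1 1 = 0" "ricci_coeff C' 2 2 = 0"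
          using 0 by (simp_all add: sym_ricci_coeff_def)
        moreover have "ricci_coeff C' 1 2 = 0" "ricci_coeff C' 2 1 = 0" using 0 r(2,3) by simp_all
        ultimately have "ricci_coeff C' j k = 0" for j k
          using exhaust_2[of j] exhaust_2[of k] by auto
        then show False using nonflat by blast
      qed
    qed
    then obtain a where a: "(C' 1 1 1 + 1) * a = sym_ricci_coeff C' 1 1"
      "sym_ricci_coeff C' 1 2 = 0" "\<epsilon> * a = sym_ricci_coeff C' 2 2"
      using log_solitonD C'0 by auto
    define q where "q = C' 1 1 2"
    \<comment> \<open>The three log soliton equations are solved successively for
      \<open>C' 2 2 2\<close>, \<open>C' 1 1 1\<close> and \<open>C' 1 2 2\<close>, with
      \<open>a\<close> and \<open>q\<close> as free parameters.\<close>
    have v: "C' 2 2 2 = \<epsilon> * (2 * q)" using a(2) unfolding R by (simp add: q_def)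
    have p: "C' 1 1 1 = C' 1 2 2 + a + 1" using a(3) \<epsilon>(2) unfolding R by auto
    have t: "C' 1 2 2 = (a\<^sup>2 + 2 * a - \<epsilon> * (2 * q\<^sup>2)) / 2"
      using a(1) unfolding R v p q_def[symmetric] by (simp add: field_simps power2_eq_square)
    have p': "C' 1 1 1 = (a\<^sup>2 + 4 * a - \<epsilon> * (2 * q\<^sup>2) + 2) / 2"
      unfolding p t by (simp add: field_simps)
    have P: "C' = P_coeffs \<epsilon> a q"
      using coeffs_eqI[of C', OF pull(1)] unfolding P_coeffs_def C'0 v p' t q_def[symmetric] .
    have "(a, q) \<noteq> (0, 0)"
    proof
      assume 0: "(a, q) = (0, 0)"
      have "ricci_coeff C' j k = 0" for j k
        using exhaust_2[of j] exhaust_2[of k] r 0 p t v by (auto simp: q_def)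
      then show False using nonflat by blast
    qed
    moreover have "q \<ge> 0" using C'0(3) by (simp add: q_def)
    ultimately show ?thesis using lin[OF c(1), of b] P \<epsilon>(2) unfolding C'_def by blast
  next
    case 2
    \<comment> \<open>With \<open>C 2 2 1 = 0\<close>, this \<open>b\<close> removes
      \<open>C' 1 1 1\<close> and \<open>c\<close> scales \<open>C' 1 2 1\<close> to 1.\<close>
    define b where "b = - C 1 1 1 / (2 * C 1 2 1)"
    define c where "c = 1 / C 1 2 1"
    have c: "c \<noteq> 0" using 2 by (simp add: c_def)
    define C' where "C' = linear_pullback (shear b c) C"
    note pull = linear_pullback_shear[of C, OF C c, of b, folded C'_def]
    have C'0: "C' 2 2 1 = 0" "C' 1 2 1 = 1" "C' 1 1 1 = 0"
      using 2 unfolding pull by (simp_all add: b_def c_def)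
    obtain h1 h2 where "type_B_soliton_system C' h1 h2"
      using type_B_soliton_system_pullback[of C, OF C c sys] unfolding C'_def by blast
    then interpret soliton_system "C' 1 1 1" "C' 1 1 2" "C' 1 2 1" "C' 1 2 2" "C' 2 2 1" "C' 2 2 2"
      "sym_ricci_coeff C' 1 1" "sym_ricci_coeff C' 1 2" "sym_ricci_coeff C' 2 2" h1 h2 .
    have "C' 2 2 2 = 1 \<and> C' 1 2 2 = 0"
      by (rule normal_form_Q[OF C'0])
         (simp_all add: sym_ricci_coeff_def ricci_coeff_eqs[of C', OF pull(1)] C'0 field_simps)
    then have "C' = Q_coeffs (C' 1 1 2)"
      using coeffs_eqI[of C', OF pull(1)] unfolding Q_coeffs_def C'0 by simp
    then show ?thesis using lin[OF c, of b] unfolding C'_def by blast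
  next
    case 3
    interpret soliton_system "C 1 1 1" "C 1 1 2" "C 1 2 1" "C 1 2 2" "C 2 2 1" "C 2 2 2"
      "sym_ricci_coeff C 1 1" "sym_ricci_coeff C 1 2" "sym_ricci_coeff C 2 2" g1 g2
      by (rule sys)
    have "C 2 2 2 = 0"
      by (rule v_eq_0[OF 3(2,1)])
         (simp_all add: sym_ricci_coeff_def ricci_coeff_eqs[of C, OF C] 3)
    then have "type_A half_plane (type_B_connection C)"
      using type_A_type_B_iff[of C] C nf 3 by blast
    then show ?thesis using lin[of 1 0] by (auto simp: linear_pullback_id)
  qed
qed

text \<open>Isomorphism with a normal form is expressed as equality after a shear; the second
  conjunct is the description of Type A by coefficients.\<close>

theorem theorem4p9:
  fixes C :: coeffs
  assumes torsion_free: "\<And>i j k. C i j k = C j i k"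
    and non_flat: "\<not> flat_on half_plane (type_B_connection C)"
  shows "(solitons half_plane (type_B_connection C) \<noteq> {} \<longleftrightarrow>
           (\<exists>C'. linearly_equivalent C C' \<and>
              (type_A half_plane (type_B_connection C')
               \<or> (\<exists>a c. (a, c) \<noteq> (0, 0) \<and> c \<ge> 0 \<and> (C' = P_coeffs 1 a c \<or> C' = P_coeffs (- 1) a c))
               \<or> (\<exists>c. C' = Q_coeffs c))))
       \<and> (type_A half_plane (type_B_connection C) \<longleftrightarrow>
           C 1 2 1 = 0 \<and> C 2 2 1 = 0 \<and> C 2 2 2 = 0)"
proof (intro conjI iffI)
  assume "solitons half_plane (type_B_connection C) \<noteq> {}"
  then show "\<exists>C'. linearly_equivalent C C' \<and>
              (type_A half_plane (type_B_connection C')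
               \<or> (\<exists>a c. (a, c) \<noteq> (0, 0) \<and> c \<ge> 0 \<and> (C' = P_coeffs 1 a c \<or> C' = P_coeffs (- 1) a c))
               \<or> (\<exists>c. C' = Q_coeffs c))"
    using soliton_imp_normal_form[of C, OF torsion_free non_flat] by blast
next
  assume "\<exists>C'. linearly_equivalent C C' \<and>
              (type_A half_plane (type_B_connection C')
               \<or> (\<exists>a c. (a, c) \<noteq> (0, 0) \<and> c \<ge> 0 \<and> (C' = P_coeffs 1 a c \<or> C' = P_coeffs (- 1) a c))
               \<or> (\<exists>c. C' = Q_coeffs c))"
  then show "solitons half_plane (type_B_connection C) \<noteq> {}"
    using solitons_nonempty_if_normal_form[of C, OF torsion_free] by blast
qed (use type_A_type_B_iff[of C, OF torsion_free non_flat] in auto)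

end
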